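(* Let $f:[\mathrm{Re}>0]\to\mathbb{C}$ be holomorphic. Then the following are equivalent: (a) the growth condition $\sup_{\mathrm{Re}\,s>0}\frac{|f(s)|}{1+|s|}<\infty$ holds, and there exists an ordinary Dirichlet series $\sum a_nn^{-s}$ which on $[\mathrm{Re}>0]$ is Cesàro summable with limit $f$, i.e. $$f(s)=\lim_{N\to\infty}\frac1N\sum_{n=1}^{N}\sum_{k=1}^{n}a_kk^{-s}\quad\text{for all }s\in[\mathrm{Re}>0];$$ (b) $f\in H_{\infty,1}^{(\log n)}[\mathrm{Re}>0]$.
   Context: Write $[\mathrm{Re}>\sigma]=\{s\in\mathbb{C}:\mathrm{Re}\,s>\sigma\}$. For the frequency $\lambda=(\log n)_{n\ge1}$, a $\lambda$-Dirichlet series is an ordinary Dirichlet series $\sum a_nn^{-s}=\sum a_ne^{-s\log n}$ with complex coefficients. It is a $(\log n)$-Riesz germ of a holomorphic function $f:[\mathrm{Re}>0]\to\mathbb{C}$ if for some $m\ge 0$ and some $\sigma\ge 0$ one has $f(s)=\lim_{x\to\infty}\sum_{\log n<x}a_nn^{-s}\big(1-\frac{\log n}{x}\big)^m$ for all $s\in[\mathrm{Re}>\sigma]$. $H_{\infty,1}^{(\log n)}[\mathrm{Re}>0]$ is the linear space of all holomorphic $f:[\mathrm{Re}>0]\to\mathbb{C}$ which have a $(\log n)$-Riesz germ and satisfy $\sup_{\mathrm{Re}\,s>0}\frac{|f(s)|}{1+|s|}<\infty$. *)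

theory Defs
  imports "HOL-Complex_Analysis.Complex_Analysis"
begin

definition right_half_plane :: "real \<Rightarrow> complex set" where
  "right_half_plane \<sigma> = {s. Re s > \<sigma>}"

text \<open>
  The ordinary Dirichlet series with coefficients \<open>a n\<close>, \<open>n \<ge> 1\<close>, is represented by \<open>a\<close>;
  the value \<open>a 0\<close> is never used.
\<close>

text \<open>
  In the Riesz mean the base of the real power is positive for all occurring \<open>n\<close> (when \<open>x > 0\<close>),
  so for \<open>m = 0\<close> all weights are 1.
\<close>
definition riesz_mean :: "real \<Rightarrow> (nat \<Rightarrow> complex) \<Rightarrow> complex \<Rightarrow> real \<Rightarrow> complex" where
  "riesz_mean m a s x =
     (\<Sum>n | 1 \<le> n \<and> ln (real n) < x.
        a n * of_nat n powr (- s) * of_real ((1 - ln (real n) / x) powr m))"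

definition riesz_germ :: "(nat \<Rightarrow> complex) \<Rightarrow> (complex \<Rightarrow> complex) \<Rightarrow> bool" where
  "riesz_germ a f \<longleftrightarrow>
     (\<exists>m\<ge>0. \<exists>\<sigma>\<ge>0. \<forall>s\<in>right_half_plane \<sigma>. (riesz_mean m a s \<longlongrightarrow> f s) at_top)"

definition linear_growth :: "(complex \<Rightarrow> complex) \<Rightarrow> bool" where
  "linear_growth f \<longleftrightarrow>
     bdd_above ((\<lambda>s. cmod (f s) / (1 + cmod s)) ` right_half_plane 0)"

text \<open>
  A function on the open right half-plane is represented by a total function whose values
  elsewhere are irrelevant.
\<close>
definition H_infty_1_log :: "(complex \<Rightarrow> complex) set" where
  "H_infty_1_log =
     {f. f holomorphic_on right_half_plane 0 \<and> (\<exists>a. riesz_germ a f) \<and> linear_growth f}"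

definition cesaro_mean :: "(nat \<Rightarrow> complex) \<Rightarrow> complex \<Rightarrow> nat \<Rightarrow> complex" where
  "cesaro_mean a s N =
     (1 / of_nat N) * (\<Sum>n=1..N. \<Sum>k=1..n. a k * of_nat k powr (- s))"

end

theory Submission
  imports Defs
begin

text \<open>
  If the Cesaro means or the Riesz means of some order converge at a single point, the coefficients
  grow at most polynomially: for Cesaro means by differencing, for Riesz means by first raising the order to
  an integer and then taking finite differences. Hence the series converges absolutely in some half-plane,
  where all these means have the limit \<open>f s\<close>; this settles (a) implies (b) with Riesz order 0.

  For the converse, put \<open>x = N + 1\<close>. By Perron's formula the Cesaro mean is, up to the factor \<open>x / N\<close>,
  the integral of \<open>f (s + w) x\<^sup>w / (w (w + 1))\<close> over a line far to the right, divided by \<open>2 \<pi> \<i>\<close>. Linear growth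
  is borderline for absolute convergence, but \<open>f\<close> is bounded far to the right, so the Phragmen-Lindeloef principle
  improves the growth inside the half-plane to order \<open>\<theta> < 1\<close>. Shifting the line to \<open>Re w = - \<delta>\<close>
  picks up the residue \<open>f s\<close> at \<open>w = 0\<close> and leaves an integral of size \<open>O(x powr - \<delta>)\<close>.
\<close>

subsection \<open>Vertical integrals against the kernel $1/(w(w+1))$\<close>

abbreviation vertical_path :: "real \<Rightarrow> real \<Rightarrow> real \<Rightarrow> complex" where
  "vertical_path u T \<equiv> linepath (Complex u (-T)) (Complex u T)"

text \<open>The two vertical edges of the rectangle carry the integrals to be compared; only the two
  horizontal edges remain, each of length \<open>q - p\<close>. With \<open>I\<close> as the residue
  contribution, this serves both for closing a contour far away and for moving the line of
  integration across a pole.\<close>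

lemma rectpath_vertical_difference:
  assumes "p < q" "T > 0"
    and h: "(h has_contour_integral I) (rectpath (Complex p (-T)) (Complex q T))"
    and bound: "\<And>w. Re w \<in> {p..q} \<Longrightarrow> \<bar>Im w\<bar> = T \<Longrightarrow> norm (h w) \<le> B"
  shows "norm (contour_integral (vertical_path q T) h - contour_integral (vertical_path p T) h - I)
           \<le> 2 * (q - p) * B"
proof -
  let ?a = "Complex p (-T)" and ?b = "Complex q (-T)" and ?c = "Complex q T" and ?d = "Complex p T"
  have hi: "h contour_integrable_on (linepath ?a ?b +++ linepath ?b ?c +++ linepath ?c ?d +++ linepath ?d ?a)"
    using h by (auto simp: rectpath_def Let_def contour_integrable_on_def)
  hence int: "h contour_integrable_on linepath ?a ?b" "h contour_integrable_on linepath ?b ?c"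
     "h contour_integrable_on linepath ?c ?d" "h contour_integrable_on linepath ?d ?a"
    by auto
  have "I = contour_integral (rectpath ?a ?c) h"
    using h by (simp add: contour_integral_unique)
  also have "\<dots> = contour_integral (linepath ?a ?b) h + contour_integral (linepath ?b ?c) h
      + contour_integral (linepath ?c ?d) h + contour_integral (linepath ?d ?a) h"
    using int by (simp add: rectpath_def Let_def)
  also have "contour_integral (linepath ?d ?a) h = - contour_integral (linepath ?a ?d) h"
    using contour_integral_reversepath[of "linepath ?a ?d" h] by simp
  finally have eq: "contour_integral (vertical_path q T) h - contour_integral (vertical_path p T) h - I
     = - (contour_integral (linepath ?a ?b) h + contour_integral (linepath ?c ?d) h)"
    by simp
  have B0: "0 \<le> B"
    using order_trans[OF norm_ge_zero bound[of ?a]] assms by simp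
  have n1: "norm (?b - ?a) = q - p" "norm (?d - ?c) = q - p"
    using assms by (auto simp: cmod_def)
  have "norm (contour_integral (linepath ?a ?b) h) \<le> B * norm (?b - ?a)"
    using int(1) B0 bound assms
    by (intro contour_integral_bound_linepath) (auto simp: closed_segment_same_Im closed_segment_eq_real_ivl)
  moreover have "norm (contour_integral (linepath ?c ?d) h) \<le> B * norm (?d - ?c)"
    using int(3) B0 bound assms
    by (intro contour_integral_bound_linepath) (auto simp: closed_segment_same_Im closed_segment_eq_real_ivl)
  ultimately have "norm (contour_integral (linepath ?a ?b) h + contour_integral (linepath ?c ?d) h)
      \<le> B * (q - p) + B * (q - p)"
    using n1 by (intro norm_triangle_le add_mono) auto
  thus ?thesis by (subst eq, subst norm_minus_cancel) (simp add: algebra_simps)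
qed

text \<open>Cauchy's integral formula handles a pole inside the rectangle, Cauchy's theorem one to
  the left of it. Covering both cases lets the choice of \<open>p\<close> decide later which poles
  are enclosed.\<close>

lemma has_contour_integral_rectpath_simple_pole:
  assumes g: "g holomorphic_on S" and S: "open S" "convex S"
    and sub: "cbox (Complex p (-T)) (Complex q T) \<subseteq> S"
    and "T > 0" "p < q" "Im z = 0" "Re z < q" "Re z \<noteq> p"
  shows "((\<lambda>w. g w / (w - z)) has_contour_integral 2 * pi * \<i> * (if p < Re z then g z else 0))
           (rectpath (Complex p (-T)) (Complex q T))" (is "(?h has_contour_integral ?I) ?R")
proof -
  have im: "path_image ?R \<subseteq> cbox (Complex p (-T)) (Complex q T)"
    using assms by (intro path_image_rectpath_subset_cbox) auto
  show ?thesis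
  proof (cases "p < Re z")
    case True
    have z: "z \<in> box (Complex p (-T)) (Complex q T)"
      using True assms by (auto simp: in_box_complex_iff)
    hence "z \<in> S" using sub box_subset_cbox by blast
    have "z \<notin> path_image ?R"
      using z assms by (subst path_image_rectpath_cbox_minus_box) auto
    hence "(?h has_contour_integral (2*pi * \<i> * winding_number ?R z * g z)) ?R"
      using im sub \<open>z \<in> S\<close> S g
      by (intro Cauchy_integral_formula_convex_simple[of S]) (auto simp: interior_open)
    thus ?thesis using winding_number_rectpath[OF z] True by simp
  next
    case False
    have ne: "w - z \<noteq> 0" if "w \<in> cbox (Complex p (-T)) (Complex q T)" for w
      using that False assms by (auto simp: in_cbox_complex_iff complex_eq_iff)
    have "(?h has_contour_integral 0) ?R"
      using im g sub ne
      by (intro Cauchy_theorem_convex_simple[of _ "cbox (Complex p (-T)) (Complex q T)"]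
            holomorphic_intros) (auto intro: holomorphic_on_subset)
    thus ?thesis using False by simp
  qed
qed

text \<open>Partial fractions, \<open>1 / (w * (w + 1)) = 1 / w - 1 / (w + 1)\<close>, leave two
  simple poles with residues \<open>g 0\<close> and \<open>- g (-1)\<close>.\<close>

lemma has_contour_integral_rectpath_kernel:
  assumes g: "g holomorphic_on S" and S: "open S" "convex S"
    and sub: "cbox (Complex p (-T)) (Complex q T) \<subseteq> S"
    and "T > 0" "p < q" "q > 0" "p \<noteq> 0" "p \<noteq> -1"
  shows "((\<lambda>w. g w / (w * (w + 1))) has_contour_integral
           2 * pi * \<i> * ((if p < 0 then g 0 else 0) - (if p < -1 then g (-1) else 0)))
           (rectpath (Complex p (-T)) (Complex q T))"
proof -
  let ?R = "rectpath (Complex p (-T)) (Complex q T)"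
  have 1: "((\<lambda>w. g w / (w - 0)) has_contour_integral 2 * pi * \<i> * (if p < Re 0 then g 0 else 0)) ?R"
    by (rule has_contour_integral_rectpath_simple_pole[OF g S sub]) (use assms in auto)
  have 2: "((\<lambda>w. g w / (w - (-1))) has_contour_integral 2 * pi * \<i> * (if p < Re (-1) then g (-1) else 0)) ?R"
    by (rule has_contour_integral_rectpath_simple_pole[OF g S sub]) (use assms in auto)
  have 3: "w \<noteq> 0" "w + 1 \<noteq> 0" if "w \<in> path_image ?R" for w
  proof -
    have "Im w \<noteq> 0 \<or> Re w = p \<or> Re w = q"
      using that assms by (subst (asm) path_image_rectpath) auto
    thus "w \<noteq> 0" "w + 1 \<noteq> 0" using assms by (auto simp: complex_eq_iff)
  qed
  show ?thesis
  proof (rule has_contour_integral_eq)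
    show "((\<lambda>w. g w / (w - 0) - g w / (w - (-1))) has_contour_integral 
        2 * pi * \<i> * ((if p < 0 then g 0 else 0) - (if p < -1 then g (-1) else 0))) ?R"
      using has_contour_integral_diff[OF 1 2] by (simp add: right_diff_distrib)
    fix w assume "w \<in> path_image ?R"
    from 3[OF this] show "g w / (w - 0) - g w / (w - (-1)) = g w / (w * (w + 1))"
      by (simp add: divide_simps) (simp add: algebra_simps)
  qed
qed

lemma norm_vertical_difference: "T \<ge> 0 \<Longrightarrow> norm (Complex u T - Complex u (- T)) = 2 * T"
  by (simp add: cmod_def real_sqrt_mult)

text \<open>No pole lies to the right of \<open>c > 0\<close>, so the integral can be moved to the
  three other edges of a rectangle of width \<open>T\<close>. They have total length
  \<open>4 * T\<close>, and the kernel is at most \<open>1 / T\<^sup>2\<close> on them.\<close>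

lemma contour_integral_kernel_close_right:
  assumes g: "g holomorphic_on {w. Re w > b}" and "b < c" "c > 0"
    and M: "\<And>w. Re w \<ge> c \<Longrightarrow> norm (g w) \<le> M" and "T > 0"
  shows "norm (contour_integral (vertical_path c T) (\<lambda>w. g w / (w * (w + 1)))) \<le> 4 * M / T"
proof -
  let ?h = "\<lambda>w. g w / (w * (w + 1))"
  have M0: "M \<ge> 0" using order_trans[OF norm_ge_zero M[of "of_real c"]] by simp
  have hb: "norm (?h w) \<le> M / T\<^sup>2" if "Re w \<ge> c" "norm w \<ge> T" for w
  proof -
    have "norm w \<le> norm (w + 1)"
      using that assms unfolding cmod_def
      by (intro real_sqrt_le_mono add_mono) (auto intro!: power_mono)
    hence "T * T \<le> norm w * norm (w + 1)"
      using that assms by (intro mult_mono) auto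
    thus ?thesis using that assms M[of w] M0
      by (auto simp: norm_divide norm_mult power2_eq_square intro!: frac_le)
  qed
  have I: "(?h has_contour_integral 2 * pi * \<i> * ((if c < 0 then g 0 else 0) - (if c < -1 then g (-1) else 0)))
     (rectpath (Complex c (-T)) (Complex (c + T) T))"
    by (rule has_contour_integral_rectpath_kernel[OF g])
       (use assms in \<open>auto simp: open_halfspace_Re_gt convex_halfspace_Re_gt in_cbox_complex_iff\<close>)
  hence I: "(?h has_contour_integral 0) (rectpath (Complex c (-T)) (Complex (c + T) T))"
    using assms by simp
  have "norm (contour_integral (vertical_path (c + T) T) ?h - contour_integral (vertical_path c T) ?h - 0)
      \<le> 2 * (c + T - c) * (M / T\<^sup>2)"
  proof (rule rectpath_vertical_difference[OF _ _ I])
    fix w assume w: "Re w \<in> {c..c+T}" "\<bar>Im w\<bar> = T"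
    show "norm (?h w) \<le> M / T\<^sup>2"
      using w abs_Im_le_cmod[of w] by (intro hb) auto
  qed (use assms in auto)
  moreover have "norm (contour_integral (vertical_path (c + T) T) ?h) \<le> M / T\<^sup>2 * norm (Complex (c + T) T - Complex (c + T) (-T))"
  proof (rule contour_integral_bound_linepath)
    have "g holomorphic_on {w. Re w > max b 0}" using g by (rule holomorphic_on_subset) auto
    moreover have "w \<noteq> 0" "w + 1 \<noteq> 0" if "Re w > 0" for w
      using that by (auto simp: complex_eq_iff)
    ultimately have "?h holomorphic_on {w. Re w > max b 0}"
      by (intro holomorphic_intros) auto
    hence "continuous_on (closed_segment (Complex (c + T) (-T)) (Complex (c + T) T)) ?h"
      using assms by (intro holomorphic_on_imp_continuous_on) (auto simp: closed_segment_same_Re elim!: holomorphic_on_subset)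
    thus "?h contour_integrable_on vertical_path (c + T) T" by (rule contour_integrable_continuous_linepath)
    fix w assume "w \<in> closed_segment (Complex (c + T) (-T)) (Complex (c + T) T)"
    hence "Re w = c + T" by (simp add: closed_segment_same_Re)
    moreover have "norm w \<ge> Re w" by (rule complex_Re_le_cmod)
    ultimately show "norm (?h w) \<le> M / T\<^sup>2" using assms by (intro hb) auto
  qed (use M0 in auto)
  moreover have "norm (Complex (c + T) T - Complex (c + T) (-T)) = 2 * T"
    using assms by (simp add: norm_vertical_difference)
  ultimately have "norm (contour_integral (vertical_path c T) ?h) \<le> 2 * T * (M / T\<^sup>2) + M / T\<^sup>2 * (2 * T)"
    by (smt (verit) norm_triangle_ineq4 diff_0_right norm_minus_commute norm_triangle_ineq2)
  also have "\<dots> = 4 * M / T" using assms by (simp add: power2_eq_square field_simps)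
  finally show ?thesis .
qed

text \<open>Closing to the left encloses both poles. The far edge is placed at
  \<open>-(T + 1)\<close> so that \<open>norm w\<close> and \<open>norm (w + 1)\<close> are both at
  least \<open>T\<close> there; the edges again have length linear in \<open>T\<close>.\<close>

lemma contour_integral_kernel_close_left:
  assumes g: "g holomorphic_on UNIV" and "c > 0"
    and M: "\<And>w. Re w \<le> c \<Longrightarrow> norm (g w) \<le> M" and "T \<ge> 1"
  shows "norm (contour_integral (vertical_path c T) (\<lambda>w. g w / (w * (w + 1))) - 2 * pi * \<i> * (g 0 - g (-1)))
           \<le> (2 * c + 6) * M / T"
proof -
  let ?h = "\<lambda>w. g w / (w * (w + 1))" and ?p = "-(T+1)"
  have M0: "M \<ge> 0" using order_trans[OF norm_ge_zero M[of "of_real c"]] by simp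
  have hb: "norm (?h w) \<le> M / T\<^sup>2" if "Re w \<le> c" "norm w \<ge> T" "norm (w + 1) \<ge> T" for w
  proof -
    have "T * T \<le> norm w * norm (w + 1)"
      using that assms by (intro mult_mono) auto
    thus ?thesis using that assms M[of w] M0
      by (auto simp: norm_divide norm_mult power2_eq_square intro!: frac_le)
  qed
  have I: "(?h has_contour_integral 2 * pi * \<i> * ((if ?p < 0 then g 0 else 0) - (if ?p < -1 then g (-1) else 0)))
     (rectpath (Complex ?p (-T)) (Complex c T))"
    by (rule has_contour_integral_rectpath_kernel[OF g]) (use assms in auto)
  hence I: "(?h has_contour_integral 2 * pi * \<i> * (g 0 - g (-1))) (rectpath (Complex ?p (-T)) (Complex c T))"
    using assms by simp
  have 1: "norm (contour_integral (vertical_path c T) ?h - contour_integral (vertical_path ?p T) ?h - 2 * pi * \<i> * (g 0 - g (-1)))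
      \<le> 2 * (c - ?p) * (M / T\<^sup>2)"
  proof (rule rectpath_vertical_difference[OF _ _ I])
    fix w assume w: "Re w \<in> {?p..c}" "\<bar>Im w\<bar> = T"
    show "norm (?h w) \<le> M / T\<^sup>2"
      using w abs_Im_le_cmod[of w] abs_Im_le_cmod[of "w+1"] by (intro hb) auto
  qed (use assms in auto)
  have 2: "norm (contour_integral (vertical_path ?p T) ?h) \<le> M / T\<^sup>2 * norm (Complex ?p T - Complex ?p (-T))"
  proof (rule contour_integral_bound_linepath)
    have "g holomorphic_on {w. Re w < -1}" using g by (rule holomorphic_on_subset) auto
    moreover have "w \<noteq> 0" "w + 1 \<noteq> 0" if "Re w < -1" for w
      using that by (auto simp: complex_eq_iff)
    ultimately have "?h holomorphic_on {w. Re w < -1}"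
      by (intro holomorphic_intros) auto
    hence "continuous_on (closed_segment (Complex ?p (-T)) (Complex ?p T)) ?h"
      using assms by (intro holomorphic_on_imp_continuous_on) (auto simp: closed_segment_same_Re elim!: holomorphic_on_subset)
    thus "?h contour_integrable_on vertical_path ?p T" by (rule contour_integrable_continuous_linepath)
    fix w assume "w \<in> closed_segment (Complex ?p (-T)) (Complex ?p T)"
    hence "Re w = ?p" by (simp add: closed_segment_same_Re)
    thus "norm (?h w) \<le> M / T\<^sup>2" using assms abs_Re_le_cmod[of w] abs_Re_le_cmod[of "w+1"]
      by (intro hb) auto
  qed (use M0 in auto)
  have 3: "norm (Complex ?p T - Complex ?p (-T)) = 2 * T"
    using assms by (simp add: norm_vertical_difference)
  have "norm (contour_integral (vertical_path c T) ?h - 2 * pi * \<i> * (g 0 - g (-1)))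
     = norm ((contour_integral (vertical_path c T) ?h - contour_integral (vertical_path ?p T) ?h - 2 * pi * \<i> * (g 0 - g (-1))) + contour_integral (vertical_path ?p T) ?h)"
    by simp
  also have "\<dots> \<le> 2 * (c - ?p) * (M / T\<^sup>2) + M / T\<^sup>2 * (2 * T)"
    using 1 2 unfolding 3 by (intro norm_triangle_le add_mono)
  also have "\<dots> = (2 * c + 4 * T + 2) * M / T\<^sup>2" using assms by (simp add: field_simps)
  also have "\<dots> \<le> ((2 * c + 6) * T) * M / T\<^sup>2"
  proof (intro divide_right_mono mult_right_mono M0)
    have "c * 1 \<le> c * T" using assms by (intro mult_left_mono) auto
    hence "2 * c + 4 * T + 2 \<le> 2 * (c * T) + 6 * T" using assms by linarith
    thus "2 * c + 4 * T + 2 \<le> (2 * c + 6) * T" by (simp add: algebra_simps)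
  qed auto
  also have "\<dots> = (2 * c + 6) * M / T" using assms by (simp add: power2_eq_square field_simps)
  finally show ?thesis .
qed

lemma has_integral_one_add_powr:
  assumes "\<theta> < 1" "T > 0"
  shows "((\<lambda>t. (1 + t) powr (\<theta> - 2)) has_integral (1 - (1 + T) powr (\<theta> - 1)) / (1 - \<theta>)) {0..T::real}"
proof -
  have "((\<lambda>t. (1 + t) powr (\<theta> - 2)) has_integral
       (\<lambda>t. - ((1 + t) powr (\<theta> - 1) / (1 - \<theta>))) T - (\<lambda>t. - ((1 + t) powr (\<theta> - 1) / (1 - \<theta>))) 0) {0..T}"
  proof (rule fundamental_theorem_of_calculus)
    fix t assume "t \<in> {0..T}"
    hence "((\<lambda>t. (1 + t) powr (\<theta> - 1)) has_real_derivative (\<theta> - 1) * (1 + t) powr (\<theta> - 2)) (at t within {0..T})"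
      by (auto intro!: derivative_eq_intros)
    from DERIV_minus[OF DERIV_cdivide[OF this, of "1 - \<theta>"]]
    have "((\<lambda>t. - ((1 + t) powr (\<theta> - 1) / (1 - \<theta>))) has_real_derivative (1 + t) powr (\<theta> - 2)) (at t within {0..T})"
      by (rule DERIV_cong) (use assms in \<open>simp add: divide_simps, simp add: algebra_simps\<close>)
    thus "((\<lambda>t. - ((1 + t) powr (\<theta> - 1) / (1 - \<theta>))) has_vector_derivative (1 + t) powr (\<theta> - 2)) (at t within {0..T})"
      by (simp add: has_real_derivative_iff_has_vector_derivative)
  qed (use assms in auto)
  thus ?thesis using assms by (simp add: diff_divide_distrib)
qed

text \<open>As \<open>\<theta> - 2 < -1\<close>, the majorant is integrable over the whole line, so
  the bound is independent of \<open>T\<close>. A reflection reduces the lower half of the path to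
  the upper one.\<close>

lemma norm_contour_integral_vertical_path_le:
  assumes h: "continuous_on {w. Re w = p} h"
    and "\<theta> < 1" "T > 0" "A \<ge> 0"
    and b: "\<And>t. norm (h (Complex p t)) \<le> A * (1 + \<bar>t\<bar>) powr (\<theta> - 2)"
  shows "norm (contour_integral (vertical_path p T) h) \<le> 2 * A / (1 - \<theta>)"
proof -
  have bd: "norm (integral {0..T} k) \<le> A / (1 - \<theta>)" 
    if k: "continuous_on {0..T} k" "\<And>t. t \<in> {0..T} \<Longrightarrow> norm (k t) \<le> A * (1 + t) powr (\<theta> - 2)" for k :: "real \<Rightarrow> complex"
  proof -
    note I = has_integral_mult_right[OF has_integral_one_add_powr[OF assms(2,3)], of A]
    have "norm (integral {0..T} k) \<le> integral {0..T} (\<lambda>t. A * (1 + t) powr (\<theta> - 2))"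
      using k by (intro integral_norm_bound_integral integrable_continuous_interval has_integral_integrable[OF I]) auto
    also have "\<dots> = A * ((1 - (1 + T) powr (\<theta> - 1)) / (1 - \<theta>))"
      using I by (rule integral_unique)
    also have "\<dots> \<le> A * (1 / (1 - \<theta>))"
      using assms by (intro mult_left_mono divide_right_mono) auto
    finally show ?thesis by simp
  qed
  have cont: "continuous_on S (\<lambda>t. h (Complex p (\<sigma> t)))" if "continuous_on S \<sigma>" for S \<sigma>
    by (rule continuous_on_compose2[OF h]) (use that in \<open>auto simp: Complex_eq intro!: continuous_intros\<close>)
  have "contour_integral (vertical_path p T) h = \<i> * integral {-T..T} (\<lambda>t. h (Complex p t))"
    by (rule contour_integral_linepath_same_Re) (use assms in auto)
  also have "integral {-T..T} (\<lambda>t. h (Complex p t)) = integral {-T..0} (\<lambda>t. h (Complex p t)) + integral {0..T} (\<lambda>t. h (Complex p t))"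
    using assms by (intro Henstock_Kurzweil_Integration.integral_combine[symmetric] integrable_continuous_interval cont) (auto intro: continuous_intros)
  also have "integral {-T..0} (\<lambda>t. h (Complex p t)) = integral {0..T} (\<lambda>t. h (Complex p (-t)))"
    using Henstock_Kurzweil_Integration.integral_reflect_real[of T 0 "\<lambda>t. h (Complex p (-t))"] by simp
  finally have "norm (contour_integral (vertical_path p T) h)
     = norm (integral {0..T} (\<lambda>t. h (Complex p (-t))) + integral {0..T} (\<lambda>t. h (Complex p t)))"
    by (simp add: norm_mult)
  also have "\<dots> \<le> A / (1 - \<theta>) + A / (1 - \<theta>)"
    by (intro norm_triangle_le add_mono bd cont) (use b in \<open>auto intro!: continuous_intros\<close>, (metis abs_minus_cancel abs_of_nonneg b)+)
  finally show ?thesis by simp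
qed

subsection \<open>Growth in the half-plane and Cesaro summability\<close>

lemma norm_of_nat_powr: "norm (of_nat n powr z :: complex) = real n powr Re z"
  by (subst norm_powr_real_powr) auto

text \<open>
  To bound \<open>f\<close> at height \<open>Im s\<close>, the maximum principle is applied on a rectangle around that
  height to \<open>f\<close> times \<open>P powr ((z - B) / (B - \<eta>)) / (1 + z - \<i> Im s)\<close>, \<open>P = 3 + \<bar>Im s\<bar>\<close>;
  the denominator absorbs the linear growth, so no decay at infinity is required.
\<close>
lemma phragmen_lindelof_linear_growth:
  assumes f: "f holomorphic_on {s. Re s > 0}" and "0 < \<eta>" "\<eta> < B"
    and M: "\<And>s. Re s > 0 \<Longrightarrow> norm (f s) \<le> M * (1 + norm s)"
    and K: "\<And>s. Re s = B \<Longrightarrow> norm (f s) \<le> K"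
    and s: "\<eta> \<le> Re s" "Re s \<le> B"
  shows "norm (f s) \<le> max (2 * M) K * (1 + Re s) * (3 + \<bar>Im s\<bar>) powr ((B - Re s) / (B - \<eta>))"
proof -
  define P where "P = 3 + \<bar>Im s\<bar>"
  define q where "q = (\<lambda>z. 1 + z - \<i> * Im s)"
  define h where "h = (\<lambda>z. f z * exp ((z - B) / (B - \<eta>) * of_real (ln P)) / q z)"
  define R where "R = cbox (Complex \<eta> (Im s - P)) (Complex B (Im s + P))"
  have P: "P \<ge> 3" by (simp add: P_def)
  have M0: "M \<ge> 0"
  proof -
    have "0 \<le> M * (1 + norm s)"
      using order_trans[OF norm_ge_zero M[of s]] s assms by auto
    thus ?thesis by (simp add: zero_le_mult_iff add_nonneg_nonneg) (smt (verit) norm_ge_zero)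
  qed
  have norm_exp: "norm (exp ((z - B) / (B - \<eta>) * of_real (ln P))) = P powr ((Re z - B) / (B - \<eta>))" for z :: complex
  proof -
    have "Re ((z - B) / (B - \<eta>) * of_real (ln P)) = (Re z - B) / (B - \<eta>) * ln P"
      by (simp del: of_real_diff add: of_real_diff[symmetric])
    thus ?thesis using P by (simp add: powr_def mult.commute)
  qed
  have q1: "norm (q z) \<ge> 1 + Re z" "norm (q z) \<ge> \<bar>Im z - Im s\<bar>" for z
    using abs_Re_le_cmod[of "q z"] abs_Im_le_cmod[of "q z"] by (auto simp: q_def)
  have nz: "norm z \<le> norm (q z) + norm (1 - \<i> * Im s)" for z
  proof -
    have "z = q z - (1 - \<i> * Im s)" by (simp add: q_def)
    thus ?thesis by (metis norm_triangle_ineq4)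
  qed
  have n1: "norm (1 - \<i> * Im s) \<le> 1 + \<bar>Im s\<bar>"
    by (rule order_trans[OF norm_triangle_ineq4]) (simp add: norm_mult)
  have nz': "1 + norm z \<le> norm (q z) + (P - 1)" for z
    unfolding P_def using nz[of z] n1 by linarith
  have hR: "h holomorphic_on {z. Re z > 0}"
  proof -
    have "q z \<noteq> 0" if "Re z > 0" for z using q1(1)[of z] that by auto
    thus ?thesis unfolding h_def q_def using assms(2,3)
      by (intro holomorphic_intros f) (auto simp: q_def)
  qed
  have sub: "R \<subseteq> {z. Re z > 0}" using assms by (auto simp: R_def in_cbox_complex_iff)
  have sR: "s \<in> R" using s P by (auto simp: R_def in_cbox_complex_iff)
  have "norm (h s) \<le> max (2 * M) K"
  proof (rule maximum_modulus_frontier[of h R])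
    show "h holomorphic_on interior R"
      using hR by (rule holomorphic_on_subset) (use sub interior_subset in blast)
    show "continuous_on (closure R) h"
      using hR sub by (simp add: R_def) (meson holomorphic_on_imp_continuous_on holomorphic_on_subset)
    show "bounded R" by (simp add: R_def)
    fix z assume "z \<in> frontier R"
    hence z: "\<eta> \<le> Re z" "Re z \<le> B" "Re z = \<eta> \<or> Re z = B \<or> \<bar>Im z - Im s\<bar> = P"
      by (auto simp: R_def frontier_def in_cbox_complex_iff in_box_complex_iff interior_cbox)
    have qz: "norm (q z) \<ge> 1" using q1(1)[of z] z assms by auto
    have hz: "norm (h z) = norm (f z) / norm (q z) * P powr ((Re z - B) / (B - \<eta>))"
      unfolding h_def norm_mult norm_divide norm_exp by simp
    have fz: "norm (f z) \<le> M * (norm (q z) + (P - 1))"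
      using M[of z] z assms nz'[of z] M0 by (meson mult_left_mono order_less_le_trans order_trans)
    consider "Re z = \<eta>" | "Re z = B" | "\<bar>Im z - Im s\<bar> = P" using z by blast
    thus "norm (h z) \<le> max (2 * M) K"
    proof cases
      \<comment> \<open>The exponential factor has norm \<open>1 / P\<close> on this edge, which
        pays for the factor \<open>P\<close> lost in bounding the linear growth by
        \<open>M * (norm (q z) * P)\<close>.\<close>
      case 1
      have "norm (q z) + (P - 1) \<le> norm (q z) * P"
        using qz P mult_right_mono[of 1 "norm (q z)" "P - 1"] by (simp add: algebra_simps)
      hence "norm (f z) \<le> M * (norm (q z) * P)"
        using fz M0 by (meson mult_left_mono order_trans)
      hence "norm (f z) / norm (q z) \<le> M * P"
        using qz M0 P by (simp add: divide_simps mult_ac split: if_splits)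
      hence "norm (h z) \<le> M * P * P powr ((Re z - B) / (B - \<eta>))"
        unfolding hz by (intro mult_right_mono) auto
      also have "(Re z - B) / (B - \<eta>) = -1" using 1 assms by (simp add: divide_simps)
      also have "M * P * P powr -1 = M" using P by (simp add: powr_minus)
      finally show ?thesis using M0 by auto
    next
      case 2
      have "norm (f z) / norm (q z) \<le> norm (f z) / 1"
        using qz by (intro divide_left_mono) auto
      thus ?thesis using K[OF 2] 2 P by (auto simp: hz)
    next
      \<comment> \<open>At vertical distance \<open>P\<close> from \<open>s\<close> the denominator
        \<open>q\<close> alone absorbs the linear growth; the exponential factor only has to stay
        below 1.\<close>
      case 3
      have "norm (q z) \<ge> P" using q1(2)[of z] 3 by simp
      hence "M * (norm (q z) + (P - 1)) \<le> M * (2 * norm (q z))" using M0 by (intro mult_left_mono) auto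
      hence "norm (f z) \<le> M * (2 * norm (q z))"
        using fz by linarith
      hence "norm (f z) / norm (q z) \<le> 2 * M"
        using qz M0 P by (simp add: divide_simps mult_ac split: if_splits)
      moreover have "P powr ((Re z - B) / (B - \<eta>)) \<le> P powr 0"
        using z P assms by (intro powr_mono divide_nonpos_pos) auto
      ultimately have "norm (h z) \<le> 2 * M * 1"
        unfolding hz using P M0 by (intro mult_mono) auto
      thus ?thesis by simp
    qed
  qed (use sR in auto)
  moreover have "norm (f s) = norm (h s) * (1 + Re s) * P powr ((B - Re s) / (B - \<eta>))"
  proof -
    \<comment> \<open>The shift by \<open>\<i> * Im s\<close> makes \<open>q\<close> real at
      \<open>s\<close>, so undoing the division costs only \<open>1 + Re s\<close>, whatever the
      height.\<close>
    have "q s = of_real (1 + Re s)" by (simp add: q_def complex_eq_iff)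
    hence "norm (q s) = 1 + Re s" using s assms by (simp del: of_real_add)
    moreover have "P powr ((Re s - B) / (B - \<eta>)) * P powr ((B - Re s) / (B - \<eta>)) = 1"
      using P by (simp add: powr_add[symmetric] add_divide_distrib[symmetric])
    moreover have "1 + Re s \<noteq> 0" using s assms by auto
    ultimately show ?thesis
      unfolding h_def norm_mult norm_divide norm_exp by simp
  qed
  ultimately show ?thesis using s assms unfolding P_def[symmetric]
    by (auto intro!: mult_right_mono)
qed

text \<open>
  The terms with \<open>n > N\<close> are integrated by closing the contour to the right, the remaining Dirichlet
  polynomial by closing it to the left; no termwise Perron formula is needed.
\<close>
lemma dirichlet_perron:
  fixes a :: "nat \<Rightarrow> complex"
  assumes f: "f holomorphic_on {s. Re s > 0}" and "B > 0" "Re s > 0"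
    and sm: "summable (\<lambda>n. norm (a n) * real n powr - B)"
    and fs: "\<And>z. Re z \<ge> B \<Longrightarrow> (\<lambda>n. a n * of_nat n powr - z) sums f z"
    and "T \<ge> 1"
  shows "norm (contour_integral (vertical_path B T) (\<lambda>w. f (s + w) * exp (w * ln (real (N + 1))) / (w * (w + 1)))
       - 2 * pi * \<i> * (\<Sum>k=1..N. a k * of_nat k powr - s * of_real (1 - real k / real (N + 1))))
      \<le> (2 * B + 10) * (real (N + 1) powr B * (\<Sum>n. norm (a n) * real n powr - B)) / T"
proof -
  define x where "x = real (N + 1)"
  define E where "E = (\<lambda>k (w::complex). a k * of_nat k powr - s * exp (w * ln (x / real k)))"
  define G where "G = (\<lambda>w. f (s + w) * exp (w * of_real (ln x)))"
  define Q where "Q = (\<lambda>w. \<Sum>k=1..N. E k w)"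
  define M where "M = x powr B * (\<Sum>n. norm (a n) * real n powr - B)"
  have x: "x > 0" by (simp add: x_def)
  \<comment> \<open>Since \<open>0 powr z = 0\<close>, index 0 contributes nothing, whatever the
    value of \<open>a 0\<close>.\<close>
  have E0: "E 0 w = 0" for w by (simp add: E_def)
  have E_bound: "norm (E n w) \<le> x powr B * (norm (a n) * real n powr - B)"
    if "(n > N \<and> Re w \<ge> B) \<or> (n \<le> N \<and> Re w \<le> B)" for n w
  proof (cases "n = 0")
    case False
    have "norm (E n w) = norm (a n) * real n powr (- Re s) * (x / real n) powr Re w"
      using False x by (simp add: E_def norm_mult norm_of_nat_powr powr_def[of "x / real n"] mult.commute)
    also have "\<dots> \<le> norm (a n) * 1 * (x / real n) powr B"
    proof (intro mult_mono)
      show "real n powr (- Re s) \<le> 1"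
        using False assms powr_mono[of "- Re s" 0 "real n"] by simp
      \<comment> \<open>With \<open>x = N + 1\<close>, the ratio \<open>x / n\<close> is at most 1
        for \<open>n > N\<close> and at least 1 for \<open>1 \<le> n \<le> N\<close>. Hence the tail
        is under control to the right of \<open>B\<close> and the polynomial to the left of
        it.\<close>
      show "(x / real n) powr Re w \<le> (x / real n) powr B"
        using that
      proof
        assume "n > N \<and> Re w \<ge> B"
        thus ?thesis using x by (intro powr_mono') (auto simp: x_def)
      next
        assume "n \<le> N \<and> Re w \<le> B"
        thus ?thesis using x False by (intro powr_mono) (auto simp: x_def)
      qed
    qed auto
    also have "\<dots> = x powr B * (norm (a n) * real n powr - B)"
      using x False by (simp add: powr_divide powr_minus field_simps)
    finally show ?thesis .
  qed (simp add: E0)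
  have smM: "summable (\<lambda>n. x powr B * (norm (a n) * real n powr - B))"
    by (rule summable_mult[OF sm])
  have M_eq: "M = (\<Sum>n. x powr B * (norm (a n) * real n powr - B))"
    unfolding M_def by (rule suminf_mult[OF sm, symmetric])
  have Q_bound: "norm (Q w) \<le> M" if "Re w \<le> B" for w
  proof -
    have "norm (Q w) \<le> (\<Sum>k=1..N. x powr B * (norm (a k) * real k powr - B))"
      unfolding Q_def using that by (intro sum_norm_le E_bound) auto
    also have "\<dots> \<le> M" unfolding M_eq by (intro sum_le_suminf smM) auto
    finally show ?thesis .
  qed
  have GQ_bound: "norm (G w - Q w) \<le> M" if w: "Re w \<ge> B" for w
  proof -
    have "(\<lambda>n. a n * of_nat n powr - (s + w) * exp (w * of_real (ln x))) sums (f (s + w) * exp (w * of_real (ln x)))"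
      using w assms by (intro sums_mult2 fs) auto
    also have "(\<lambda>n. a n * of_nat n powr - (s + w) * exp (w * of_real (ln x))) = (\<lambda>n. E n w)"
    proof
      fix n show "a n * of_nat n powr - (s + w) * exp (w * of_real (ln x)) = E n w"
      proof (cases "n = 0")
        case False
        have "of_nat n powr - (s + w) = of_nat n powr (- s) * exp (- (w * ln (real n)))"
          using False by (simp add: powr_def Ln_of_nat exp_add[symmetric] algebra_simps)
        thus ?thesis using False x by (simp add: E_def ln_div exp_diff exp_minus field_simps)
      qed (simp add: E0)
    qed
    finally have E: "(\<lambda>n. E n w) sums G w" by (simp add: G_def)
    hence "(\<lambda>n. E (n + Suc N) w) sums (G w - (\<Sum>i<Suc N. E i w))"
      by (rule sums_split_initial_segment)
    also have "(\<Sum>i<Suc N. E i w) = Q w"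
      unfolding Q_def by (intro sum.mono_neutral_right) (auto simp: E0 not_less_eq_eq)
    finally have "G w - Q w = (\<Sum>n. E (n + Suc N) w)" by (simp add: sums_iff)
    also have "norm \<dots> \<le> (\<Sum>n. x powr B * (norm (a (n + Suc N)) * real (n + Suc N) powr - B))"
      using w by (intro norm_suminf_le E_bound summable_ignore_initial_segment[OF smM]) auto
    also have "\<dots> \<le> M"
      unfolding M_eq suminf_split_initial_segment[OF smM, of "Suc N"] le_add_same_cancel1
      by (intro sum_nonneg) auto
    finally show ?thesis .
  qed
  have Qh: "Q holomorphic_on UNIV"
    unfolding Q_def E_def by (intro holomorphic_intros)
  have Gh: "G holomorphic_on {w. Re w > - Re s}"
  proof -
    have "(f \<circ> (\<lambda>w. s + w)) holomorphic_on {w. Re w > - Re s}"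
      by (rule holomorphic_on_compose_gen[OF _ f]) (auto intro!: holomorphic_intros)
    thus ?thesis unfolding G_def o_def by (intro holomorphic_intros)
  qed
  have GQh: "(\<lambda>w. G w - Q w) holomorphic_on {w. Re w > - Re s}"
    using Gh Qh by (intro holomorphic_on_diff) (auto intro: holomorphic_on_subset)
  have right: "norm (contour_integral (vertical_path B T) (\<lambda>w. (G w - Q w) / (w * (w + 1)))) \<le> 4 * M / T"
    using assms GQh GQ_bound by (intro contour_integral_kernel_close_right) auto
  have left: "norm (contour_integral (vertical_path B T) (\<lambda>w. Q w / (w * (w + 1))) - 2 * pi * \<i> * (Q 0 - Q (-1))) \<le> (2 * B + 6) * M / T"
    using assms Qh Q_bound by (intro contour_integral_kernel_close_left) auto
  have int: "(\<lambda>w. u w / (w * (w + 1))) contour_integrable_on vertical_path B T"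
    if "u holomorphic_on {w. Re w > - Re s}" for u
  proof (rule contour_integrable_continuous_linepath)
    have ne: "w \<noteq> 0" "w + 1 \<noteq> 0" if "Re w = B" for w
      using that assms by (auto simp: complex_eq_iff)
    have "continuous_on {w. Re w = B} u"
      using assms by (intro holomorphic_on_imp_continuous_on holomorphic_on_subset[OF that]) auto
    hence "continuous_on {w. Re w = B} (\<lambda>w. u w / (w * (w + 1)))"
      by (intro continuous_intros) (use ne in auto)
    thus "continuous_on (closed_segment (Complex B (- T)) (Complex B T)) (\<lambda>w. u w / (w * (w + 1)))"
      by (rule continuous_on_subset) (auto simp: closed_segment_same_Re)
  qed
  have "contour_integral (vertical_path B T) (\<lambda>w. G w / (w * (w + 1)))
      = contour_integral (vertical_path B T) (\<lambda>w. (G w - Q w) / (w * (w + 1)) + Q w / (w * (w + 1)))"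
    by (simp add: diff_divide_distrib)
  also have "\<dots> = contour_integral (vertical_path B T) (\<lambda>w. (G w - Q w) / (w * (w + 1)))
       + contour_integral (vertical_path B T) (\<lambda>w. Q w / (w * (w + 1)))"
    by (intro contour_integral_add int GQh holomorphic_on_subset[OF Qh]) auto
  finally have "norm (contour_integral (vertical_path B T) (\<lambda>w. G w / (w * (w + 1))) - 2 * pi * \<i> * (Q 0 - Q (-1)))
     \<le> 4 * M / T + (2 * B + 6) * M / T"
    using norm_triangle_le[OF add_mono[OF right left]] by (simp add: algebra_simps)
  also have "\<dots> = (2 * B + 10) * M / T"
    by (simp add: add_divide_distrib[symmetric] algebra_simps)
  \<comment> \<open>The residue at -1 multiplies the \<open>k\<close>-th term by
    \<open>k / x\<close>; subtracting it from the residue at 0 creates the Cesaro weights.\<close>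
  also have "Q 0 - Q (-1) = (\<Sum>k=1..N. a k * of_nat k powr - s * of_real (1 - real k / x))"
    unfolding Q_def sum_subtractf[symmetric]
  proof (rule sum.cong)
    fix k assume "k \<in> {1..N}"
    hence "exp (- of_real (ln (x / real k))) = complex_of_real (real k / x)"
      using x by (simp add: exp_minus exp_of_real)
    thus "E k 0 - E k (-1) = a k * of_nat k powr - s * of_real (1 - real k / x)"
      by (simp add: E_def algebra_simps)
  qed auto
  finally show ?thesis by (simp add: G_def x_def M_def)
qed

section \<open>Cesaro means and the shift of the contour past the origin\<close>

text \<open>The \<open>k\<close>-th term occurs in the partial sums of index \<open>k\<close> to
  \<open>N\<close>, that is \<open>N + 1 - k\<close> times. Pulling out \<open>N + 1\<close> rather
  than \<open>N\<close> gives exactly the weights that the kernel produces at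
  \<open>x = N + 1\<close>.\<close>

lemma cesaro_mean_eq:
  "cesaro_mean a s N = of_real (real (N + 1) / real N) *
     (\<Sum>k=1..N. a k * of_nat k powr - s * of_real (1 - real k / real (N + 1)))"
proof (cases "N = 0")
  case False
  have "(\<Sum>n=1..N. \<Sum>k=1..n. a k * of_nat k powr - s) =
        (\<Sum>(n,k)\<in>(SIGMA n:{1..N}. {1..n}). a k * of_nat k powr - s)"
    by (rule sum.Sigma) auto
  also have "\<dots> = (\<Sum>(k,n)\<in>(SIGMA k:{1..N}. {k..N}). a k * of_nat k powr - s)"
    by (rule sum.reindex_bij_witness[of _ "\<lambda>(k,n). (n,k)" "\<lambda>(k,n). (n,k)"]) auto
  also have "\<dots> = (\<Sum>k=1..N. \<Sum>n=k..N. a k * of_nat k powr - s)"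
    by (rule sum.Sigma[symmetric]) auto
  also have "\<dots> = (\<Sum>k=1..N. of_nat (N + 1) * (a k * of_nat k powr - s * of_real (1 - real k / real (N + 1))))"
  proof (rule sum.cong)
    fix k assume "k \<in> {1..N}"
    hence "of_nat (Suc N - k) = complex_of_real (real (N + 1) * (1 - real k / real (N + 1)))"
      by (subst of_real_of_nat_eq[symmetric], subst of_real_eq_iff) (simp add: field_simps of_nat_diff)
    thus "(\<Sum>n=k..N. a k * of_nat k powr - s) =
       of_nat (N + 1) * (a k * of_nat k powr - s * of_real (1 - real k / real (N + 1)))"
      by (simp only: sum_constant card_atLeastAtMost) simp
  qed auto
  finally show ?thesis
    unfolding cesaro_mean_def sum_distrib_left[symmetric] using False by simp
qed (simp add: cesaro_mean_def)

text \<open>On this line \<open>x\<close> to the power \<open>w\<close> has norm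
  \<open>x powr - \<delta>\<close>, and the kernel decays like \<open>(1 + abs t) powr - 2\<close>,
  which makes growth of order \<open>\<theta> < 1\<close> integrable. The bound
  \<open>\<delta> \<le> 1 / 2\<close> keeps the line at least as far from -1 as from 0.\<close>

lemma norm_contour_integral_left_of_origin_le:
  assumes f: "f holomorphic_on {s. Re s > 0}" and "0 < \<delta>" "\<delta> \<le> 1 / 2" "\<delta> < Re s"
    and \<theta>: "0 \<le> \<theta>" "\<theta> < 1" and "K \<ge> 0"
    and bound: "\<And>z. Re z = Re s - \<delta> \<Longrightarrow> norm (f z) \<le> K * (3 + \<bar>Im z\<bar>) powr \<theta>"
    and "x > 0" "T > 0"
  shows "norm (contour_integral (vertical_path (-\<delta>) T) (\<lambda>w. f (s + w) * exp (w * of_real (ln x)) / (w * (w + 1))))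
     \<le> 2 * (K * (3 + \<bar>Im s\<bar>) * 4 / \<delta>\<^sup>2 * x powr - \<delta>) / (1 - \<theta>)"
proof (rule norm_contour_integral_vertical_path_le)
  have ne: "w \<noteq> 0" "w + 1 \<noteq> 0" if "Re w = - \<delta>" for w
    using that assms by (auto simp: complex_eq_iff)
  have "continuous_on {w. Re w = - \<delta>} (\<lambda>w. f (s + w))"
    by (rule continuous_on_compose2[OF holomorphic_on_imp_continuous_on[OF f]])
       (use assms in \<open>auto intro!: continuous_intros\<close>)
  thus "continuous_on {w. Re w = - \<delta>} (\<lambda>w. f (s + w) * exp (w * of_real (ln x)) / (w * (w + 1)))"
    by (intro continuous_intros) (use ne in auto)
  fix t :: real
  define w where "w = Complex (-\<delta>) t"
  have "norm (f (s + w)) \<le> K * (3 + \<bar>Im s + t\<bar>) powr \<theta>"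
    using bound[of "s + w"] by (simp add: w_def)
  \<comment> \<open>Bounding the base by a product separates the fixed height \<open>Im s\<close>
    from the variable \<open>t\<close>.\<close>
  also have "\<dots> \<le> K * ((3 + \<bar>Im s\<bar>) * (1 + \<bar>t\<bar>)) powr \<theta>"
  proof (intro mult_left_mono powr_mono2 assms)
    have "3 + \<bar>Im s\<bar> + 1 * \<bar>t\<bar> \<le> 3 + \<bar>Im s\<bar> + (3 + \<bar>Im s\<bar>) * \<bar>t\<bar>"
      by (intro add_left_mono mult_right_mono) auto
    thus "3 + \<bar>Im s + t\<bar> \<le> (3 + \<bar>Im s\<bar>) * (1 + \<bar>t\<bar>)"
      using abs_triangle_ineq[of "Im s" t] by (simp add: distrib_left)
  qed auto
  also have "\<dots> = K * ((3 + \<bar>Im s\<bar>) powr \<theta> * (1 + \<bar>t\<bar>) powr \<theta>)"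
    by (simp add: powr_mult)
  also have "\<dots> \<le> K * ((3 + \<bar>Im s\<bar>) powr 1 * (1 + \<bar>t\<bar>) powr \<theta>)"
    using assms by (intro mult_left_mono mult_right_mono powr_mono) auto
  finally have fw: "norm (f (s + w)) \<le> K * (3 + \<bar>Im s\<bar>) * (1 + \<bar>t\<bar>) powr \<theta>"
    by simp
  \<comment> \<open>Because \<open>\<delta> \<le> 1\<close>, the left side is at most the mean of
    \<open>\<delta>\<close> and \<open>abs t\<close>, hence at most their maximum.\<close>
  have "\<delta> / 2 * (1 + \<bar>t\<bar>) \<le> max \<delta> \<bar>t\<bar>"
  proof -
    have "\<delta> * \<bar>t\<bar> \<le> 1 * \<bar>t\<bar>" using assms by (intro mult_right_mono) auto
    thus ?thesis by (simp add: algebra_simps max_def)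
  qed
  moreover have "max \<delta> \<bar>t\<bar> \<le> norm w" "max \<delta> \<bar>t\<bar> \<le> norm (w + 1)"
    using abs_Re_le_cmod[of w] abs_Im_le_cmod[of w] abs_Re_le_cmod[of "w + 1"] abs_Im_le_cmod[of "w + 1"] assms
    by (auto simp: w_def)
  ultimately have "\<delta> / 2 * (1 + \<bar>t\<bar>) * (\<delta> / 2 * (1 + \<bar>t\<bar>)) \<le> norm w * norm (w + 1)"
    using assms by (intro mult_mono) auto
  hence den: "\<delta>\<^sup>2 / 4 * (1 + \<bar>t\<bar>)\<^sup>2 \<le> norm (w * (w + 1))"
    by (simp add: norm_mult power2_eq_square mult_ac)
  have "norm (exp (w * of_real (ln x))) = x powr - \<delta>"
    using assms by (simp add: w_def powr_def)
  hence "norm (f (s + w) * exp (w * of_real (ln x)) / (w * (w + 1))) = norm (f (s + w)) * x powr - \<delta> / norm (w * (w + 1))"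
    by (simp add: norm_mult norm_divide)
  also have "\<dots> \<le> K * (3 + \<bar>Im s\<bar>) * (1 + \<bar>t\<bar>) powr \<theta> * x powr - \<delta> / (\<delta>\<^sup>2 / 4 * (1 + \<bar>t\<bar>)\<^sup>2)"
    using assms fw den by (intro frac_le mult_right_mono) (auto intro!: mult_pos_pos simp: add_nonneg_eq_0_iff)
  also have "\<dots> = K * (3 + \<bar>Im s\<bar>) * 4 / \<delta>\<^sup>2 * x powr - \<delta> * ((1 + \<bar>t\<bar>) powr \<theta> / (1 + \<bar>t\<bar>)\<^sup>2)"
    using assms by (simp add: field_simps)
  also have "(1 + \<bar>t\<bar>) powr \<theta> / (1 + \<bar>t\<bar>)\<^sup>2 = (1 + \<bar>t\<bar>) powr (\<theta> - 2)"
    by (simp add: powr_diff)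
  finally show "norm (f (s + Complex (-\<delta>) t) * exp (Complex (-\<delta>) t * of_real (ln x)) / (Complex (-\<delta>) t * (Complex (-\<delta>) t + 1)))
     \<le> K * (3 + \<bar>Im s\<bar>) * 4 / \<delta>\<^sup>2 * x powr - \<delta> * (1 + \<bar>t\<bar>) powr (\<theta> - 2)"
    by (simp add: w_def)
qed (use assms in auto)

text \<open>As \<open>0 < \<delta> < 1\<close>, the rectangle encloses 0 but not -1, so
  \<open>f s\<close> is the only residue. Linear growth suffices on the horizontal edges:
  \<open>f\<close> is of size \<open>T\<close> there, against a kernel of size
  \<open>1 / T\<^sup>2\<close>.\<close>

lemma norm_shifted_contour_difference_le:
  assumes f: "f holomorphic_on {s. Re s > 0}" and "0 < \<delta>" "\<delta> < 1" "\<delta> < Re s" "B > 0" "x \<ge> 1" "T \<ge> 1"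
    and M: "\<And>s. Re s > 0 \<Longrightarrow> norm (f s) \<le> M * (1 + norm s)"
  shows "norm (contour_integral (vertical_path B T) (\<lambda>w. f (s + w) * exp (w * of_real (ln x)) / (w * (w + 1)))
      - contour_integral (vertical_path (-\<delta>) T) (\<lambda>w. f (s + w) * exp (w * of_real (ln x)) / (w * (w + 1)))
      - 2 * pi * \<i> * f s) \<le> 2 * (B + \<delta>) * (M * (4 + norm s + B) * x powr B) / T"
proof -
  define G where "G = (\<lambda>w. f (s + w) * exp (w * of_real (ln x)))"
  have Gh: "G holomorphic_on {w. Re w > - Re s}"
  proof -
    have "(f \<circ> (\<lambda>w. s + w)) holomorphic_on {w. Re w > - Re s}"
      by (rule holomorphic_on_compose_gen[OF _ f]) (auto intro!: holomorphic_intros)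
    thus ?thesis unfolding G_def o_def by (intro holomorphic_intros)
  qed
  have M0: "M \<ge> 0"
  proof (rule ccontr)
    assume "\<not> M \<ge> 0"
    hence "M * (1 + norm (1::complex)) < 0" by simp
    thus False using order_trans[OF norm_ge_zero M[of 1]] by simp
  qed
  have "((\<lambda>w. G w / (w * (w + 1))) has_contour_integral 2 * pi * \<i> * ((if -\<delta> < 0 then G 0 else 0) - (if -\<delta> < -1 then G (-1) else 0)))
     (rectpath (Complex (-\<delta>) (-T)) (Complex B T))"
    by (rule has_contour_integral_rectpath_kernel[OF Gh])
       (use assms in \<open>auto simp: open_halfspace_Re_gt convex_halfspace_Re_gt in_cbox_complex_iff\<close>)
  hence I: "((\<lambda>w. G w / (w * (w + 1))) has_contour_integral 2 * pi * \<i> * f s)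
     (rectpath (Complex (-\<delta>) (-T)) (Complex B T))"
    using assms by (simp add: G_def)
  have "norm (contour_integral (vertical_path B T) (\<lambda>w. G w / (w * (w + 1)))
      - contour_integral (vertical_path (-\<delta>) T) (\<lambda>w. G w / (w * (w + 1)))
      - 2 * pi * \<i> * f s) \<le> 2 * (B - (-\<delta>)) * (M * (4 + norm s + B) * T * x powr B / (T * T))"
  proof (rule rectpath_vertical_difference[OF _ _ I])
    fix w assume w: "Re w \<in> {-\<delta>..B}" "\<bar>Im w\<bar> = T"
    have "norm (s + w) \<le> norm s + (\<bar>Re w\<bar> + \<bar>Im w\<bar>)"
      by (meson add_left_mono cmod_le norm_triangle_ineq order_trans)
    also have "\<dots> \<le> norm s + (B + 1 + T)" using w assms by auto
    finally have "1 + norm (s + w) \<le> (2 + norm s + B) * 1 + T" by simp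
    also have "\<dots> \<le> (2 + norm s + B) * T + T * 1"
      using assms by (intro add_mono mult_left_mono) auto
    also have "\<dots> \<le> (4 + norm s + B) * T" using assms by (simp add: algebra_simps)
    finally have "norm (f (s + w)) \<le> M * ((4 + norm s + B) * T)"
      using M[of "s + w"] w assms M0 by (smt (verit) mult_left_mono atLeastAtMost_iff plus_complex.sel(1))
    moreover have "norm (exp (w * of_real (ln x))) \<le> x powr B"
      using w assms by (simp add: powr_def mult_right_mono)
    ultimately have "norm (G w) \<le> M * ((4 + norm s + B) * T) * x powr B"
      unfolding G_def norm_mult
      by (rule mult_mono) (use M0 assms in \<open>auto intro!: mult_nonneg_nonneg\<close>)
    moreover have "T * T \<le> norm (w * (w + 1))"
      unfolding norm_mult using w assms abs_Im_le_cmod[of w] abs_Im_le_cmod[of "w + 1"] by (intro mult_mono) auto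
    ultimately show "norm (G w / (w * (w + 1))) \<le> M * (4 + norm s + B) * T * x powr B / (T * T)"
      unfolding norm_divide using assms by (intro frac_le) (auto simp: mult_ac intro: order_trans[OF norm_ge_zero])
  qed (use assms in auto)
  also have "\<dots> = 2 * (B + \<delta>) * (M * (4 + norm s + B) * x powr B) / T"
    using assms by simp
  finally show ?thesis by (simp add: G_def)
qed

lemma cesaro_mean_tendstoI:
  assumes "(\<lambda>N. \<Sum>k=1..N. a k * of_nat k powr - s * of_real (1 - real k / real (N + 1))) \<longlonglongrightarrow> l"
  shows "cesaro_mean a s \<longlonglongrightarrow> l"
proof -
  have "(\<lambda>N. real (N + 1) / real N) \<longlonglongrightarrow> 1"
  proof (rule Lim_transform_eventually)
    show "(\<lambda>N. 1 + 1 / real N) \<longlonglongrightarrow> 1"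
      using tendsto_add[OF tendsto_const[of 1] lim_1_over_n] by simp
    show "\<forall>\<^sub>F N in sequentially. 1 + 1 / real N = real (N + 1) / real N"
      using eventually_gt_at_top[of 0] by eventually_elim (simp add: field_simps)
  qed
  from tendsto_mult[OF tendsto_of_real[OF this, where 'a=complex] assms]
  show ?thesis by (simp add: cesaro_mean_eq[abs_def])
qed

text \<open>Lets \<open>T\<close> tend to infinity in a final estimate, so that all vertical
  integrals can stay truncated and no improper integral is needed.\<close>

lemma le_of_le_add_divide:
  fixes X Y R :: real
  assumes "\<And>T. T \<ge> 1 \<Longrightarrow> X \<le> Y + R / T"
  shows "X \<le> Y"
proof (rule tendsto_lowerbound)
  have "((\<lambda>T. Y + R / T) \<longlongrightarrow> Y + 0) at_top"
    by (intro tendsto_intros tendsto_divide_0[OF tendsto_const] filterlim_at_top_imp_at_infinity filterlim_ident)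
  thus "((\<lambda>T. Y + R / T) \<longlongrightarrow> Y) at_top" by simp
  show "\<forall>\<^sub>F T in at_top. X \<le> Y + R / T"
    using eventually_ge_at_top[of 1] by eventually_elim (rule assms)
qed simp

lemma summable_norm_dirichlet_mono:
  fixes a :: "nat \<Rightarrow> complex"
  assumes "summable (\<lambda>n. norm (a n) * real n powr - B)" "B \<le> C"
  shows "summable (\<lambda>n. norm (a n) * real n powr - C)"
proof (rule summable_comparison_test'[OF assms(1)])
  fix n :: nat
  show "norm (norm (a n) * real n powr - C) \<le> norm (a n) * real n powr - B"
    using assms(2) by (cases "n = 0") (auto intro!: mult_left_mono powr_mono)
qed

text \<open>Perron's formula and the contour shift are compared at a common height \<open>T\<close>,
  for fixed \<open>N\<close>. Their errors grow with \<open>N\<close> but vanish as \<open>T\<close>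
  grows, so \<open>T\<close> goes to infinity first; what survives is
  \<open>A * x powr - \<delta>\<close> with \<open>A\<close> independent of
  \<open>N\<close>.\<close>

lemma cesaro_mean_tendsto_of_linear_growth:
  fixes a :: "nat \<Rightarrow> complex"
  assumes f: "f holomorphic_on {s. Re s > 0}"
    and M: "\<And>z. Re z > 0 \<Longrightarrow> norm (f z) \<le> M * (1 + norm z)"
    and sm: "summable (\<lambda>n. norm (a n) * real n powr - B0)"
    and fs: "\<And>z. Re z \<ge> B0 \<Longrightarrow> (\<lambda>n. a n * of_nat n powr - z) sums f z"
    and s: "Re s > 0"
  shows "cesaro_mean a s \<longlonglongrightarrow> f s"
proof -
  define B where "B = max B0 (Re s + 1)"
  define S where "S = (\<Sum>n. norm (a n) * real n powr - B)"
  \<comment> \<open>As \<open>\<delta> \<le> Re s / 2\<close>, the line at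
    \<open>Re s - \<delta>\<close> lies strictly to the right of \<open>\<eta> = Re s / 4\<close>;
    this gap makes \<open>\<theta> < 1\<close>. The choice of \<open>B\<close> keeps that line to
    the left of the one where the absolutely convergent series bounds \<open>f\<close>.\<close>
  define \<delta> where "\<delta> = min (Re s / 2) (1 / 2)"
  define \<eta> where "\<eta> = Re s / 4"
  define \<theta> where "\<theta> = (B - (Re s - \<delta>)) / (B - \<eta>)"
  define K where "K = max (2 * M) S * (1 + (Re s - \<delta>))"
  define C where "C = (\<lambda>N. \<Sum>k=1..N. a k * of_nat k powr - s * of_real (1 - real k / real (N + 1)))"
  define A where "A = 2 * (K * (3 + \<bar>Im s\<bar>) * 4 / \<delta>\<^sup>2) / (1 - \<theta>)"
  have B: "B \<ge> B0" "B \<ge> Re s + 1" "B > 0" using s by (auto simp: B_def)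
  have smB: "summable (\<lambda>n. norm (a n) * real n powr - B)"
    using sm B(1) by (rule summable_norm_dirichlet_mono)
  have fsB: "(\<lambda>n. a n * of_nat n powr - z) sums f z" if "Re z \<ge> B" for z
    using that B by (intro fs) auto
  have S: "norm (f z) \<le> S" if "Re z = B" for z
  proof -
    have "f z = (\<Sum>n. a n * of_nat n powr - z)" using fsB[of z] that by (simp add: sums_iff)
    also have "norm \<dots> \<le> S"
      unfolding S_def using that by (intro norm_suminf_le smB) (simp add: norm_mult norm_of_nat_powr)
    finally show ?thesis .
  qed
  have S0: "S \<ge> 0" unfolding S_def by (intro suminf_nonneg smB) auto
  have \<delta>: "0 < \<delta>" "\<delta> \<le> 1 / 2" "\<delta> \<le> Re s / 2" "\<delta> < Re s" using s by (auto simp: \<delta>_def min_def)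
  have \<eta>: "0 < \<eta>" "\<eta> < B" "\<eta> < Re s - \<delta>" using s \<delta> B by (auto simp: \<eta>_def)
  have \<theta>: "0 \<le> \<theta>" "\<theta> < 1" using \<eta> \<delta> B by (auto simp: \<theta>_def)
  have K0: "K \<ge> 0" using S0 \<delta> by (auto simp: K_def)
  have fK: "norm (f z) \<le> K * (3 + \<bar>Im z\<bar>) powr \<theta>" if "Re z = Re s - \<delta>" for z
    using phragmen_lindelof_linear_growth[OF f \<eta>(1,2) M S, of z] that \<eta> \<delta> B
    by (simp add: K_def \<theta>_def)
  have bound: "norm (C N - f s) \<le> A / (2 * pi) * real (N + 1) powr - \<delta>" for N
  proof -
    define x where "x = real (N + 1)"
    define R1 where "R1 = (2 * B + 10) * (x powr B * S)"
    define R2 where "R2 = 2 * (B + \<delta>) * (M * (4 + norm s + B) * x powr B)"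
    have "norm (2 * pi * \<i> * (C N - f s)) \<le> A * x powr - \<delta>"
    proof (rule le_of_le_add_divide)
      fix T :: real assume T: "T \<ge> 1"
      define V where "V = (\<lambda>u. contour_integral (vertical_path u T) (\<lambda>w. f (s + w) * exp (w * of_real (ln x)) / (w * (w + 1))))"
      have 1: "norm (V B - 2 * pi * \<i> * C N) \<le> R1 / T"
        unfolding V_def C_def R1_def S_def x_def
        by (rule dirichlet_perron[OF f _ _ smB]) (use B s T fsB in auto)
      have 2: "norm (V B - V (-\<delta>) - 2 * pi * \<i> * f s) \<le> R2 / T"
        unfolding V_def R2_def
        by (rule norm_shifted_contour_difference_le[OF f]) (use \<delta> B T M in \<open>auto simp: x_def\<close>)
      have 3: "norm (V (-\<delta>)) \<le> A * x powr - \<delta>"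
        using norm_contour_integral_left_of_origin_le[OF f \<delta>(1,2,4) \<theta> K0 fK, of x T] T
        by (simp add: V_def A_def x_def algebra_simps)
      have "2 * pi * \<i> * (C N - f s) = V (-\<delta>) - (V B - 2 * pi * \<i> * C N) + (V B - V (-\<delta>) - 2 * pi * \<i> * f s)"
        by (simp add: algebra_simps)
      also have "norm \<dots> \<le> (A * x powr - \<delta> + R1 / T) + R2 / T"
        by (rule norm_triangle_le[OF add_mono[OF order_trans[OF norm_triangle_ineq4 add_mono[OF 3 1]] 2]])
      also have "\<dots> = A * x powr - \<delta> + (R1 + R2) / T" by (simp add: add_divide_distrib)
      finally show "norm (2 * pi * \<i> * (C N - f s)) \<le> A * x powr - \<delta> + (R1 + R2) / T" .
    qed
    hence "2 * pi * norm (C N - f s) \<le> A * x powr - \<delta>" by (simp add: norm_mult)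
    thus ?thesis by (simp add: field_simps x_def)
  qed
  have x_lim: "(\<lambda>N. real (N + 1) powr - \<delta>) \<longlonglongrightarrow> 0"
    by (rule tendsto_neg_powr[OF _ filterlim_compose[OF filterlim_real_sequentially filterlim_add_const_nat_at_top]])
       (use \<delta> in simp)
  have "(\<lambda>N. C N - f s) \<longlonglongrightarrow> 0"
  proof (rule Lim_null_comparison)
    show "\<forall>\<^sub>F N in sequentially. norm (C N - f s) \<le> A / (2 * pi) * real (N + 1) powr - \<delta>"
      using bound by simp
    show "(\<lambda>N. A / (2 * pi) * real (N + 1) powr - \<delta>) \<longlonglongrightarrow> 0"
      using tendsto_mult_right_zero[OF x_lim] .
  qed
  hence "C \<longlonglongrightarrow> f s" using Lim_null by blast
  thus ?thesis unfolding C_def by (rule cesaro_mean_tendstoI)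
qed

subsection \<open>Growth of the coefficients\<close>

text \<open>Writing \<open>P\<close> for the shifted \<open>p\<close>, the difference for
  \<open>a + X * p\<close> is \<open>X * (P - p) + h * P\<close>, which drives the induction. Only
  an upper bound on the degree is assumed, so a vanishing coefficient needs no special
  treatment.\<close>

lemma pcompose_shift_difference:
  fixes q :: "'a :: idom poly"
  assumes "degree q \<le> k"
  shows "degree (pcompose q [:h, 1:] - q) \<le> k - 1"
    and "coeff (pcompose q [:h, 1:] - q) (k - 1) = of_nat k * h * coeff q k"
  using assms
proof (induction q arbitrary: k rule: pCons_induct)
  case (pCons a p)
  define P where "P = pcompose p [:h, 1:]"
  have eq: "pcompose (pCons a p) [:h, 1:] - pCons a p = pCons 0 (P - p) + smult h P"
    by (simp add: pcompose_pCons P_def poly_eq_iff coeff_pCons split: nat.splits)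
  {
    case 1
    show ?case
    proof (cases "p = 0")
      case False
      then obtain j where k: "k = Suc j" and j: "degree p \<le> j"
        using 1 by (cases k) auto
      have "degree P \<le> j" using j by (simp add: P_def degree_pcompose)
      moreover have "degree (pCons 0 (P - p)) \<le> j"
        using pCons.IH(1)[OF j] j by (cases j) (auto simp: P_def degree_pCons_eq_if pcompose_pCons dest!: degree_0_id elim!: degree_eq_zeroE)
      ultimately show ?thesis unfolding eq k by (auto intro!: degree_add_le order_trans[OF degree_smult_le])
    qed (simp add: eq P_def)
  next
    case 2
    show ?case
    proof (cases "p = 0")
      case False
      then obtain j where k: "k = Suc j" and j: "degree p \<le> j"
        using 2 by (cases k) auto
      \<comment> \<open>Shifting does not change the coefficient of degree \<open>j\<close>, so
        \<open>h * P\<close> adds one more \<open>h * coeff p j\<close> to the \<open>j\<close>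
        copies from the induction hypothesis.\<close>
      have "coeff (P - p) j = 0"
      proof (cases j)
        case 0
        thus ?thesis using pCons.IH(2)[OF j] by (simp add: P_def)
      next
        case (Suc i)
        thus ?thesis using pCons.IH(1)[OF j] by (intro coeff_eq_0) (simp add: P_def)
      qed
      moreover have "coeff (pCons 0 (P - p)) j = of_nat j * h * coeff p j"
        using pCons.IH(2)[OF j] by (cases j) (auto simp: P_def)
      ultimately show ?thesis unfolding eq k by (simp add: algebra_simps)
    next
      case True
      thus ?thesis using 2 by (cases k) (auto simp: eq P_def)
    qed
  }
qed auto

text \<open>The \<open>k\<close>-th forward difference with step \<open>h\<close> is
  \<open>k! * h ^ k\<close> times the coefficient of degree \<open>k\<close>, and each differencing
  at most doubles the bound.\<close>

lemma norm_lead_coeff_le_of_equidistant: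
  fixes q :: "'a :: real_normed_field poly"
  assumes "degree q \<le> k" "\<And>j. j \<le> k \<Longrightarrow> norm (poly q (y + of_nat j * h)) \<le> M"
  shows "fact k * norm h ^ k * norm (coeff q k) \<le> 2 ^ k * M"
  using assms
proof (induction k arbitrary: q M)
  case 0
  thus ?case by (auto elim!: degree_eq_zeroE)
next
  case (Suc k)
  define r where "r = pcompose q [:h, 1:] - q"
  have r: "degree r \<le> k" "coeff r k = of_nat (Suc k) * h * coeff q (Suc k)"
    using pcompose_shift_difference[OF Suc.prems(1), of h] by (simp_all add: r_def)
  have "fact k * norm h ^ k * norm (coeff r k) \<le> 2 ^ k * (2 * M)"
  proof (rule Suc.IH[OF r(1)])
    fix j assume j: "j \<le> k"
    have "poly r (y + of_nat j * h) = poly q (y + of_nat (Suc j) * h) - poly q (y + of_nat j * h)"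
      by (simp add: r_def poly_pcompose algebra_simps)
    also have "norm \<dots> \<le> M + M"
      using j by (intro order_trans[OF norm_triangle_ineq4] add_mono Suc.prems(2)) auto
    finally show "norm (poly r (y + of_nat j * h)) \<le> 2 * M" by simp
  qed
  thus ?case using r(2) by (simp add: norm_mult algebra_simps del: of_nat_Suc)
qed

section \<open>Raising the order of Riesz sums to an integer\<close>

text \<open>The substitution \<open>t = l + (x - l) * u\<close> turns this into the Beta integral.
  The positive part extends the integrand by 0 to the left of \<open>l\<close>, so terms with
  different \<open>l\<close> share the interval \<open>{0..x}\<close>.\<close>

lemma has_integral_Beta_affine:
  fixes m p l x :: real
  assumes "m \<ge> 0" "p > 0" "0 \<le> l" "l < x"
  shows "((\<lambda>t. max 0 (t - l) powr m * (x - t) powr (p - 1)) has_integral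
           Beta (m + 1) p * (x - l) powr (m + p)) {0..x}"
proof -
  have "((\<lambda>t. t powr m * (1 - t) powr (p - 1)) has_integral Beta (m + 1) p) (cbox 0 1)"
    using has_integral_Beta_real[of "m + 1" p] assms by simp
  note A = has_integral_affinity'[OF this, of "1 / (x - l)" "- (l / (x - l))"]
  have "(0 - - (l / (x - l))) /\<^sub>R (1 / (x - l)) = l" "(1 - - (l / (x - l))) /\<^sub>R (1 / (x - l)) = x"
    using assms by (simp_all add: field_simps)
  moreover have "(1 / (x - l)) *\<^sub>R t + - (l / (x - l)) = (t - l) / (x - l)" for t
    by (simp add: diff_divide_distrib)
  moreover have "Beta (m + 1) p /\<^sub>R (1 / (x - l)) ^ DIM(real) = Beta (m + 1) p * (x - l)"
    by (simp add: mult.commute)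
  ultimately have "((\<lambda>t. ((t - l) / (x - l)) powr m * (1 - (t - l) / (x - l)) powr (p - 1)) has_integral
         Beta (m + 1) p * (x - l)) {l..x}"
    using A assms by (simp only: box_real) simp
  from has_integral_mult_right[OF this, of "(x - l) powr (m + p - 1)"]
  have "((\<lambda>t. (x - l) powr (m + p - 1) * (((t - l) / (x - l)) powr m * (1 - (t - l) / (x - l)) powr (p - 1))) has_integral
         (x - l) powr (m + p - 1) * (Beta (m + 1) p * (x - l))) {l..x}" .
  also have "(x - l) powr (m + p - 1) * (Beta (m + 1) p * (x - l)) = Beta (m + 1) p * (x - l) powr (m + p)"
    using assms powr_add[of "x - l" "m + p - 1" 1] by (simp add: mult_ac)
  finally have "((\<lambda>t. max 0 (t - l) powr m * (x - t) powr (p - 1)) has_integral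
         Beta (m + 1) p * (x - l) powr (m + p)) {l..x}"
  proof (rule has_integral_eq[rotated])
    fix t assume t: "t \<in> {l..x}"
    have "1 - (t - l) / (x - l) = (x - t) / (x - l)" using assms by (simp add: field_simps)
    moreover have "(x - l) powr (m + p - 1) = (x - l) powr m * (x - l) powr (p - 1)"
      using powr_add[of "x - l" m "p - 1"] by (simp add: algebra_simps)
    ultimately show "(x - l) powr (m + p - 1) * (((t - l) / (x - l)) powr m * (1 - (t - l) / (x - l)) powr (p - 1))
       = max 0 (t - l) powr m * (x - t) powr (p - 1)"
      using t assms by (simp add: powr_divide)
  qed
  moreover have "((\<lambda>t. max 0 (t - l) powr m * (x - t) powr (p - 1)) has_integral 0) {0..l}"
    by (rule has_integral_is_0) (simp add: max_def)
  ultimately show ?thesis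
    using has_integral_combine[of 0 l x] assms by fastforce
qed

text \<open>
  The Riesz sum of order \<open>m + p\<close> is, up to the factor \<open>Beta (m + 1) p\<close>, a fractional integral of
  order \<open>p\<close> of the one of order \<open>m\<close>. Since \<open>0 powr m = 0\<close> even for \<open>m = 0\<close>, the positive part
  discards exactly the terms with \<open>l n \<ge> t\<close>.
\<close>
lemma riesz_sum_bound_raise_order:
  fixes c :: "nat \<Rightarrow> complex" and l :: "nat \<Rightarrow> real"
  assumes "m \<ge> 0" "p > 0" "x > 0" "finite I"
    and l: "\<And>n. n \<in> I \<Longrightarrow> l n \<ge> 0"
    and bound: "\<And>t. 0 < t \<Longrightarrow> t \<le> x \<Longrightarrow> norm (\<Sum>n\<in>I. c n * of_real (max 0 (t - l n) powr m)) \<le> C * t powr m"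
  shows "norm (\<Sum>n\<in>I. c n * of_real (max 0 (x - l n) powr (m + p))) \<le> C * x powr (m + p)"
proof -
  have Beta: "Beta (m + 1) p > 0"
    using assms by (simp add: Beta_def Gamma_real_pos)
  define w where "w = (\<lambda>t. (x - t) powr (p - 1))"
  have I: "((\<lambda>t. of_real (max 0 (t - l n) powr m * w t)) has_integral
           complex_of_real (Beta (m + 1) p * max 0 (x - l n) powr (m + p))) {0..x}" if "n \<in> I" for n
  proof (cases "l n < x")
    case True
    thus ?thesis
      unfolding w_def using has_integral_Beta_affine[OF assms(1,2) l[OF that] True]
      by (intro has_integral_of_real) simp
  next
    case False
    have "((\<lambda>t. 0 :: complex) has_integral 0) {0..x}" by simp
    thus ?thesis using False
      by (subst has_integral_cong[where g = "\<lambda>t. 0"]) auto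
  qed
  have J: "((\<lambda>t. \<Sum>n\<in>I. c n * of_real (max 0 (t - l n) powr m * w t)) has_integral
      (\<Sum>n\<in>I. c n * of_real (Beta (m + 1) p * max 0 (x - l n) powr (m + p)))) {0..x}"
    by (intro has_integral_sum has_integral_mult_right I assms)
  \<comment> \<open>The majorant is the case \<open>l = 0\<close> of the same integral, so the Beta
    factor cancels and the constant \<open>C\<close> is preserved.\<close>
  have K: "((\<lambda>t. C * (max 0 (t - 0) powr m * w t)) has_integral C * (Beta (m + 1) p * (x - 0) powr (m + p))) {0..x}"
    unfolding w_def using assms by (intro has_integral_mult_right has_integral_Beta_affine) auto
  have "Beta (m + 1) p * norm (\<Sum>n\<in>I. c n * of_real (max 0 (x - l n) powr (m + p)))
     = norm (of_real (Beta (m + 1) p) * (\<Sum>n\<in>I. c n * of_real (max 0 (x - l n) powr (m + p))))"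
    using Beta by (simp add: norm_mult)
  also have "of_real (Beta (m + 1) p) * (\<Sum>n\<in>I. c n * of_real (max 0 (x - l n) powr (m + p)))
     = (\<Sum>n\<in>I. c n * of_real (Beta (m + 1) p * max 0 (x - l n) powr (m + p)))"
    by (simp add: sum_distrib_left mult_ac)
  also have "norm \<dots> \<le> C * (Beta (m + 1) p * (x - 0) powr (m + p))"
    unfolding integral_unique[OF J, symmetric] integral_unique[OF K, symmetric]
  proof (rule Henstock_Kurzweil_Integration.integral_norm_bound_integral)
    show "(\<lambda>t. \<Sum>n\<in>I. c n * of_real (max 0 (t - l n) powr m * w t)) integrable_on {0..x}"
      "(\<lambda>t. C * (max 0 (t - 0) powr m * w t)) integrable_on {0..x}"
      using J K by (blast intro: has_integral_integrable)+
    fix t assume t: "t \<in> {0..x}"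
    show "norm (\<Sum>n\<in>I. c n * of_real (max 0 (t - l n) powr m * w t)) \<le> C * (max 0 (t - 0) powr m * w t)"
    \<comment> \<open>The hypothesis covers only \<open>t > 0\<close>; at 0 all positive parts
      vanish because \<open>l n \<ge> 0\<close>.\<close>
    proof (cases "t = 0")
      case True
      have "max 0 (t - l n) = 0" if "n \<in> I" for n using l[OF that] True by simp
      thus ?thesis using True by simp
    next
      case False
      have "(\<Sum>n\<in>I. c n * of_real (max 0 (t - l n) powr m * w t))
         = (\<Sum>n\<in>I. c n * of_real (max 0 (t - l n) powr m)) * of_real (w t)"
        by (simp add: sum_distrib_left mult_ac)
      also have "norm \<dots> \<le> (C * t powr m) * w t"
        using bound[of t] t False unfolding norm_mult by (intro mult_mono) (auto simp: w_def intro: order_trans[OF norm_ge_zero])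
      finally show ?thesis using t by (simp add: mult_ac)
    qed
  qed
  finally have "Beta (m + 1) p * norm (\<Sum>n\<in>I. c n * of_real (max 0 (x - l n) powr (m + p)))
     \<le> Beta (m + 1) p * (C * x powr (m + p))" by (simp add: mult_ac)
  thus ?thesis using Beta by simp
qed

lemma finite_ln_less: "finite {n::nat. 1 \<le> n \<and> ln (real n) < x}"
proof (rule finite_subset)
  show "{n::nat. 1 \<le> n \<and> ln (real n) < x} \<subseteq> {..nat \<lceil>exp x\<rceil>}"
  proof
    fix n :: nat assume "n \<in> {n. 1 \<le> n \<and> ln (real n) < x}"
    hence "1 \<le> n" "ln (real n) < x" by auto
    hence "real n < exp x" by (metis exp_less_mono exp_ln of_nat_0_less_iff less_le_trans zero_less_one)
    thus "n \<in> {..nat \<lceil>exp x\<rceil>}" by simp linarith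
  qed
qed auto

text \<open>Clearing the normalisation leaves truncated powers, the form suited to fractional
  integration and to polynomial differences.\<close>

lemma riesz_mean_eq:
  assumes "x > 0"
  shows "of_real (x powr m) * riesz_mean m a s x =
     (\<Sum>n | 1 \<le> n \<and> ln (real n) < x. a n * of_nat n powr - s * of_real (max 0 (x - ln (real n)) powr m))"
  unfolding riesz_mean_def sum_distrib_left
proof (rule sum.cong)
  fix n assume "n \<in> {n. 1 \<le> n \<and> ln (real n) < x}"
  hence n: "ln (real n) < x" by simp
  have "1 - ln (real n) / x = (x - ln (real n)) / x" using assms by (simp add: field_simps)
  hence "x powr m * (1 - ln (real n) / x) powr m = max 0 (x - ln (real n)) powr m"
    using assms n by (simp add: powr_divide)
  thus "of_real (x powr m) * (a n * of_nat n powr - s * of_real ((1 - ln (real n) / x) powr m)) =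
     a n * of_nat n powr - s * of_real (max 0 (x - ln (real n)) powr m)"
    by (metis (no_types, lifting) mult.left_commute of_real_mult)
qed auto

text \<open>The limit controls large \<open>x\<close>; below the threshold only finitely many terms
  occur, with weights at most 1. A bound for all \<open>x > 0\<close> is required because raising
  the order integrates from 0.\<close>

lemma riesz_mean_bounded:
  assumes "(riesz_mean m a s \<longlongrightarrow> l) at_top" "m \<ge> 0"
  shows "\<exists>C\<ge>0. \<forall>x>0. norm (riesz_mean m a s x) \<le> C"
proof -
  have "\<forall>\<^sub>F x in at_top. norm (riesz_mean m a s x) < norm l + 1"
    using tendsto_norm[OF assms(1)] by (rule order_tendstoD) simp
  then obtain X where X: "\<And>x. x \<ge> X \<Longrightarrow> norm (riesz_mean m a s x) < norm l + 1"
    by (auto simp: eventually_at_top_linorder)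
  define D where "D = (\<Sum>n | 1 \<le> n \<and> ln (real n) < X. norm (a n * of_nat n powr - s))"
  have "norm (riesz_mean m a s x) \<le> max (norm l + 1) D" if "x > 0" for x
  proof (cases "x \<ge> X")
    case False
    have "norm (riesz_mean m a s x) \<le> (\<Sum>n | 1 \<le> n \<and> ln (real n) < x. norm (a n * of_nat n powr - s))"
      unfolding riesz_mean_def
    proof (rule sum_norm_le)
      fix n assume n: "n \<in> {n. 1 \<le> n \<and> ln (real n) < x}"
      hence "(1 - ln (real n) / x) powr m \<le> 1 powr m"
        using that assms by (intro powr_mono2) (auto simp: field_simps)
      thus "norm (a n * of_nat n powr - s * of_real ((1 - ln (real n) / x) powr m)) \<le> norm (a n * of_nat n powr - s)"
        unfolding norm_mult by (intro mult_left_le) (auto intro!: mult_nonneg_nonneg)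
    qed
    also have "\<dots> \<le> D" unfolding D_def using False by (intro sum_mono2 finite_ln_less) auto
    finally show ?thesis by simp
  qed (use X[of x] in simp)
  thus ?thesis by (intro exI[of _ "max (norm l + 1) D"]) (auto simp: le_max_iff_disj)
qed

text \<open>
  On the interval from \<open>ln N\<close> to \<open>ln (N + 1)\<close> the Riesz sum of integral order \<open>k\<close> is a polynomial
  with leading coefficient \<open>c 1 + \<dots> + c N\<close>, so its \<open>k\<close>-th difference controls that partial sum.
\<close>
lemma norm_partial_sum_le_of_riesz_order:
  fixes c :: "nat \<Rightarrow> complex"
  assumes N: "N \<ge> 1" and k: "k \<ge> 1"
    and bound: "\<And>x. 0 < x \<Longrightarrow> x \<le> ln (real (N + 1)) \<Longrightarrow>
       norm (\<Sum>n=1..N. c n * of_real (max 0 (x - ln (real n)) powr real k)) \<le> C * x powr real k"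
    and C: "C \<ge> 0"
  shows "norm (\<Sum>n=1..N. c n) \<le> C * (2 * real k) ^ k * real (N + 1) ^ (2 * k)"
proof -
  define L where "L = ln (real (N + 1))"
  define q where "q = (\<Sum>n=1..N. smult (c n) ([:- of_real (ln (real n)), 1:] ^ k))"
  \<comment> \<open>Divides the interval from \<open>ln N\<close> to \<open>ln (N + 1)\<close> into
    \<open>k\<close> equal steps. Its length is at least \<open>1 / (N + 1)\<close>, so dividing by
    \<open>h ^ k\<close> costs only a power of \<open>N + 1\<close>.\<close>
  define h where "h = (L - ln (real N)) / real k"
  have "ln (real N / real (N + 1)) \<le> real N / real (N + 1) - 1"
    using N by (intro ln_le_minus_one) auto
  hence "L - ln (real N) \<ge> 1 / real (N + 1)"
    using N by (simp add: L_def ln_div field_simps)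
  moreover have "1 / real (N + 1) \<ge> 0" by simp
  ultimately have "1 \<le> (L - ln (real N)) * real (N + 1)" "L - ln (real N) \<ge> 0"
    by (simp only: pos_divide_le_eq of_nat_0_less_iff add_gr_0 zero_less_one simp_thms, linarith)
  hence kh: "1 \<le> real k * h * real (N + 1)" and h: "h \<ge> 0"
    using k by (auto simp: h_def)
  have L: "L > 0" "L \<le> real (N + 1)"
    using N ln_le_minus_one[of "real (N + 1)"] by (auto simp: L_def)
  have "fact k * norm (complex_of_real h) ^ k * norm (coeff q k) \<le> 2 ^ k * (C * L ^ k)"
  proof (rule norm_lead_coeff_le_of_equidistant)
    show "degree q \<le> k"
      unfolding q_def by (intro degree_sum_le) (auto intro!: order_trans[OF degree_smult_le] simp: degree_linear_power)
    fix j assume j: "j \<le> k"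
    define x where "x = ln (real N) + real j * h"
    have "real j * h \<le> real k * h" using j h by (intro mult_right_mono) auto
    also have "\<dots> = L - ln (real N)" using k by (simp add: h_def)
    finally have x: "ln (real N) \<le> x" "x \<le> L" "0 \<le> x" using h N by (auto simp: x_def)
    have "poly q (of_real (ln (real N)) + of_nat j * of_real h) = poly q (of_real x)"
      by (simp add: x_def)
    also have "\<dots> = (\<Sum>n=1..N. c n * of_real (max 0 (x - ln (real n)) powr real k))"
      unfolding q_def poly_sum
    proof (rule sum.cong)
      fix n assume n: "n \<in> {1..N}"
      hence "ln (real n) \<le> x" using order_trans[OF _ x(1)] by simp
      \<comment> \<open>At \<open>x = ln n\<close> both sides are 0, which relies on
        \<open>k \<ge> 1\<close>.\<close>
      hence "max 0 (x - ln (real n)) powr real k = (x - ln (real n)) ^ k"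
        using k by (cases "x = ln (real n)") (auto simp: powr_realpow)
      thus "poly (smult (c n) ([:- of_real (ln (real n)), 1:] ^ k)) (of_real x) =
         c n * of_real (max 0 (x - ln (real n)) powr real k)" by (simp add: poly_power)
    qed auto
    also have "norm \<dots> \<le> C * L ^ k"
    proof (cases "x = 0")
      case True
      have "max 0 (x - ln (real n)) = 0" if "n \<in> {1..N}" for n using that True by simp
      thus ?thesis using C L by simp
    next
      case False
      hence "norm (\<Sum>n=1..N. c n * of_real (max 0 (x - ln (real n)) powr real k)) \<le> C * x powr real k"
        using x by (intro bound) (auto simp: L_def)
      also have "\<dots> \<le> C * L powr real k" using x C by (intro mult_left_mono powr_mono2) auto
      finally show ?thesis using L by (simp add: powr_realpow)
    qed
    finally show "norm (poly q (of_real (ln (real N)) + of_nat j * of_real h)) \<le> C * L ^ k" .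
  qed
  moreover have "coeff q k = (\<Sum>n=1..N. c n)"
    by (simp add: q_def coeff_sum coeff_linear_power)
  ultimately have main: "fact k * h ^ k * norm (\<Sum>n=1..N. c n) \<le> 2 ^ k * (C * L ^ k)"
    using h by simp
  have "norm (\<Sum>n=1..N. c n) = 1 * 1 * norm (\<Sum>n=1..N. c n)" by simp
  also have "\<dots> \<le> fact k * (real k * h * real (N + 1)) ^ k * norm (\<Sum>n=1..N. c n)"
    by (intro mult_mono one_le_power kh) (use h in auto)
  also have "\<dots> = (real k * real (N + 1)) ^ k * (fact k * h ^ k * norm (\<Sum>n=1..N. c n))"
    by (simp add: power_mult_distrib mult_ac)
  also have "\<dots> \<le> (real k * real (N + 1)) ^ k * (2 ^ k * (C * real (N + 1) ^ k))"
    using main by (rule mult_left_mono[OF order_trans]) (use C L in \<open>auto intro!: mult_left_mono power_mono\<close>)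
  also have "\<dots> = C * (2 * real k) ^ k * real (N + 1) ^ (2 * k)"
    unfolding mult_2[of k] power_add by (simp add: power_mult_distrib mult_ac)
  finally show ?thesis .
qed

text \<open>A term is the difference of two consecutive partial sums;
  \<open>n + 1 \<le> 2 * n\<close> turns their bound into a power of \<open>n\<close>.\<close>

lemma dirichlet_coeff_bound_of_partial_sums:
  fixes a :: "nat \<Rightarrow> complex"
  assumes bound: "\<And>N. N \<ge> 1 \<Longrightarrow> norm (\<Sum>n=1..N. a n * of_nat n powr - of_real t) \<le> C * real (N + 1) ^ j"
    and C: "C \<ge> 0" and n: "n \<ge> 1"
  shows "norm (a n) \<le> 2 * C * 2 ^ j * real n powr (real j + t)"
proof -
  define S where "S = (\<lambda>N. \<Sum>n=1..N. a n * of_nat n powr - complex_of_real t)"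
  obtain i where i: "n = Suc i" using n by (cases n) auto
  have "norm (S i) \<le> C * real (i + 1) ^ j"
    using bound[of i] C by (cases "i = 0") (auto simp: S_def)
  also have "\<dots> \<le> C * real (n + 1) ^ j" using C i by (intro mult_left_mono power_mono) auto
  finally have Si: "norm (S i) \<le> C * real (n + 1) ^ j" .
  have Sn: "norm (S n) \<le> C * real (n + 1) ^ j" unfolding S_def using n by (rule bound)
  have "norm (a n) * real n powr - t = norm (S n - S i)"
    by (simp add: S_def i norm_mult norm_of_nat_powr del: of_nat_Suc)
  also have "\<dots> \<le> C * real (n + 1) ^ j + C * real (n + 1) ^ j"
    by (rule order_trans[OF norm_triangle_ineq4 add_mono[OF Sn Si]])
  also have "\<dots> = 2 * (C * real (n + 1) ^ j)" by simp
  also have "\<dots> \<le> 2 * (C * (2 * real n) ^ j)"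
    using n C by (intro mult_left_mono power_mono) auto
  finally have "norm (a n) * real n powr - t * real n powr t \<le> 2 * (C * (2 * real n) ^ j) * real n powr t"
    by (rule mult_right_mono) simp
  thus ?thesis
    using n by (simp add: powr_minus power_mult_distrib powr_add powr_realpow mult_ac)
qed

lemma riesz_summable_coeff_bound:
  assumes lim: "(riesz_mean m a (of_real t) \<longlongrightarrow> l) at_top" and m: "m \<ge> 0"
  shows "\<exists>D K. \<forall>n\<ge>1. norm (a n) \<le> D * real n powr K"
proof -
  define c where "c = (\<lambda>n. a n * of_nat n powr - complex_of_real t)"
  obtain C where C: "C \<ge> 0" "\<And>x. x > 0 \<Longrightarrow> norm (riesz_mean m a (of_real t) x) \<le> C"
    using riesz_mean_bounded[OF lim m] by blast
  \<comment> \<open>The added 1 makes \<open>k\<close> strictly larger than \<open>m\<close> even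
    for integral \<open>m\<close>, so that the order is raised by a positive amount.\<close>
  define k where "k = nat \<lceil>m\<rceil> + 1"
  have k: "real k - m > 0" "k \<ge> 1" unfolding k_def by linarith+
  have "norm (\<Sum>n=1..N. c n) \<le> C * (2 * real k) ^ k * real (N + 1) ^ (2 * k)" if N: "N \<ge> 1" for N
  proof (rule norm_partial_sum_le_of_riesz_order[OF N k(2) _ C(1)])
    fix x assume x: "0 < x" "x \<le> ln (real (N + 1))"
    have "norm (\<Sum>n=1..N. c n * of_real (max 0 (x - ln (real n)) powr (m + (real k - m)))) \<le> C * x powr (m + (real k - m))"
    proof (rule riesz_sum_bound_raise_order[OF m k(1) x(1)])
      fix y assume y: "0 < y" "y \<le> x"
      \<comment> \<open>For \<open>y \<le> ln (N + 1)\<close> every term of the Riesz sum has index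
        at most \<open>N\<close>, and the positive part kills the additional ones. Thus one fixed
        finite index set works for all \<open>y\<close>.\<close>
      have "(\<Sum>n=1..N. c n * of_real (max 0 (y - ln (real n)) powr m))
         = (\<Sum>n | 1 \<le> n \<and> ln (real n) < y. c n * of_real (max 0 (y - ln (real n)) powr m))"
      proof (rule sum.mono_neutral_right)
        show "{n. 1 \<le> n \<and> ln (real n) < y} \<subseteq> {1..N}"
        proof safe
          fix n :: nat assume "1 \<le> n" "ln (real n) < y"
          hence "ln (real n) < ln (real (N + 1))" using x y by linarith
          hence "real n < real (N + 1)" using \<open>1 \<le> n\<close> by (subst (asm) ln_less_cancel_iff) auto
          thus "n \<in> {1..N}" using \<open>1 \<le> n\<close> by simp
        qed
      qed auto
      also have "\<dots> = of_real (y powr m) * riesz_mean m a (of_real t) y"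
        unfolding c_def by (rule riesz_mean_eq[OF y(1), symmetric])
      also have "norm \<dots> \<le> C * y powr m"
        using mult_left_mono[OF C(2)[OF y(1)], of "y powr m"] by (simp add: norm_mult mult.commute)
      finally show "norm (\<Sum>n=1..N. c n * of_real (max 0 (y - ln (real n)) powr m)) \<le> C * y powr m" .
    qed auto
    thus "norm (\<Sum>n=1..N. c n * of_real (max 0 (x - ln (real n)) powr real k)) \<le> C * x powr real k" by simp
  qed
  hence "norm (a n) \<le> 2 * (C * (2 * real k) ^ k) * 2 ^ (2 * k) * real n powr (real (2 * k) + t)" if "n \<ge> 1" for n
    unfolding c_def using C(1) that by (intro dirichlet_coeff_bound_of_partial_sums) auto
  thus ?thesis by blast
qed

lemma summable_dirichlet_of_coeff_bound:
  fixes a :: "nat \<Rightarrow> complex"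
  assumes "\<And>n. n \<ge> 1 \<Longrightarrow> norm (a n) \<le> D * real n powr K"
  shows "summable (\<lambda>n. norm (a n) * real n powr - (K + 2))"
proof (rule summable_comparison_test')
  show "summable (\<lambda>n. D * real n powr - 2)"
    by (intro summable_mult) (simp add: summable_real_powr_iff)
  fix n :: nat
  show "norm (norm (a n) * real n powr - (K + 2)) \<le> D * real n powr - 2"
  proof (cases "n = 0")
    case False
    have "norm (a n) * real n powr - (K + 2) \<le> D * real n powr K * real n powr - (K + 2)"
      using False assms[of n] by (intro mult_right_mono) auto
    also have "\<dots> = D * real n powr - 2" by (simp add: powr_add[symmetric] mult.assoc)
    finally show ?thesis by simp
  qed simp
qed

subsection \<open>Summation methods on absolutely convergent series\<close>

text \<open>Tannery's theorem with the absolutely convergent series as majorant; a general filter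
  covers both Riesz and Cesaro weights.\<close>

lemma tendsto_weighted_suminf:
  fixes c :: "nat \<Rightarrow> complex" and W :: "'b \<Rightarrow> nat \<Rightarrow> real"
  assumes "summable (\<lambda>n. norm (c n))" and "F \<noteq> bot"
    and W: "\<And>x n. \<bar>W x n\<bar> \<le> 1" "\<And>n. ((\<lambda>x. W x n) \<longlongrightarrow> 1) F"
  shows "((\<lambda>x. \<Sum>n. c n * of_real (W x n)) \<longlongrightarrow> (\<Sum>n. c n)) F"
proof -
  have "((\<lambda>x. c n * of_real (W x n)) \<longlongrightarrow> c n * of_real 1) F" for n
    by (intro tendsto_intros W)
  moreover have "\<forall>\<^sub>F (n, x) in at_top \<times>\<^sub>F F. norm (c n * of_real (W x n)) \<le> norm (c n)"
    using W(1) by (intro always_eventually) (auto simp: norm_mult mult_left_le)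
  ultimately show ?thesis
    using tannerys_theorem[of "\<lambda>n x. c n * of_real (W x n)" c F "\<lambda>n. norm (c n)"] assms(1,2) by simp
qed

lemma riesz_mean_tendsto_suminf:
  assumes m: "m \<ge> 0" and sm: "summable (\<lambda>n. norm (a n * of_nat n powr - s))"
  shows "(riesz_mean m a s \<longlongrightarrow> (\<Sum>n. a n * of_nat n powr - s)) at_top"
proof -
  \<comment> \<open>The value 1 at \<open>n = 0\<close> only ensures that every weight tends to 1;
    the term it multiplies is 0.\<close>
  define W where "W = (\<lambda>x n. if 1 \<le> n \<and> ln (real n) < x then (1 - ln (real n) / x) powr m else if n = 0 then 1 else 0)"
  have "((\<lambda>x. \<Sum>n. a n * of_nat n powr - s * of_real (W x n)) \<longlongrightarrow> (\<Sum>n. a n * of_nat n powr - s)) at_top"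
  proof (rule tendsto_weighted_suminf[OF sm])
    fix x :: real and n :: nat
    show "\<bar>W x n\<bar> \<le> 1"
    proof (cases "1 \<le> n \<and> ln (real n) < x")
      case True
      hence "x > 0" by (metis ln_ge_zero of_nat_1 of_nat_le_iff order_le_less_trans)
      hence "(1 - ln (real n) / x) powr m \<le> 1 powr m"
        using True m by (intro powr_mono2) (auto simp: field_simps)
      thus ?thesis using True by (simp add: W_def)
    qed (auto simp: W_def)
  next
    fix n :: nat
    show "((\<lambda>x. W x n) \<longlongrightarrow> 1) at_top"
    proof (cases "n = 0")
      case False
      have "((\<lambda>x. (1 - ln (real n) / x) powr m) \<longlongrightarrow> (1 - 0) powr m) at_top"
        by (intro tendsto_intros tendsto_divide_0[OF tendsto_const] filterlim_at_top_imp_at_infinity filterlim_ident) auto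
      moreover have "\<forall>\<^sub>F x in at_top. (1 - ln (real n) / x) powr m = W x n"
        using eventually_gt_at_top[of "ln (real n)"] by eventually_elim (use False in \<open>simp add: W_def\<close>)
      ultimately show ?thesis by (simp add: tendsto_cong)
    qed (simp add: W_def)
  qed simp
  moreover have "riesz_mean m a s = (\<lambda>x. \<Sum>n. a n * of_nat n powr - s * of_real (W x n))"
  proof
    fix x
    have "(\<Sum>n. a n * of_nat n powr - s * of_real (W x n)) =
       (\<Sum>n | 1 \<le> n \<and> ln (real n) < x. a n * of_nat n powr - s * of_real (W x n))"
      by (rule suminf_finite[OF finite_ln_less]) (auto simp: W_def)
    thus "riesz_mean m a s x = (\<Sum>n. a n * of_nat n powr - s * of_real (W x n))"
      by (simp add: riesz_mean_def W_def)
  qed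
  ultimately show ?thesis by simp
qed

lemma cesaro_mean_tendsto_suminf:
  assumes sm: "summable (\<lambda>n. norm (a n * of_nat n powr - s))"
  shows "cesaro_mean a s \<longlonglongrightarrow> (\<Sum>n. a n * of_nat n powr - s)"
proof (rule cesaro_mean_tendstoI)
  define W where "W = (\<lambda>N n. if n \<le> N then 1 - real n / real (N + 1) else 0)"
  have "(\<lambda>N. \<Sum>n. a n * of_nat n powr - s * of_real (W N n)) \<longlonglongrightarrow> (\<Sum>n. a n * of_nat n powr - s)"
  proof (rule tendsto_weighted_suminf[OF sm])
    fix n
    have "(\<lambda>N. 1 - real n / real (Suc N)) \<longlonglongrightarrow> 1 - 0"
      by (intro tendsto_intros LIMSEQ_Suc[OF lim_const_over_n])
    moreover have "\<forall>\<^sub>F N in sequentially. 1 - real n / real (Suc N) = W N n"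
      using eventually_ge_at_top[of n] by eventually_elim (simp add: W_def)
    ultimately show "(\<lambda>N. W N n) \<longlonglongrightarrow> 1" by (simp add: tendsto_cong)
  qed (auto simp: W_def field_simps)
  moreover have "(\<Sum>n. a n * of_nat n powr - s * of_real (W N n)) =
      (\<Sum>k=1..N. a k * of_nat k powr - s * of_real (1 - real k / real (N + 1)))" for N
  proof -
    have "(\<Sum>n. a n * of_nat n powr - s * of_real (W N n)) = (\<Sum>k=1..N. a k * of_nat k powr - s * of_real (W N k))"
      by (rule suminf_finite) (auto simp: W_def not_less_eq_eq)
    thus ?thesis by (simp add: W_def)
  qed
  ultimately show "(\<lambda>N. \<Sum>k=1..N. a k * of_nat k powr - s * of_real (1 - real k / real (N + 1))) \<longlonglongrightarrow> (\<Sum>n. a n * of_nat n powr - s)"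
    by simp
qed

text \<open>\<open>N\<close> times the Cesaro mean is the sum of the first \<open>N\<close> partial
  sums, so differencing bounded means gives partial sums of linear size.\<close>

lemma cesaro_summable_coeff_bound:
  assumes "cesaro_mean a (of_real t) \<longlonglongrightarrow> l"
  shows "\<exists>D K. \<forall>n\<ge>1. norm (a n) \<le> D * real n powr K"
proof -
  define S where "S = (\<lambda>N. \<Sum>n=1..N. a n * of_nat n powr - complex_of_real t)"
  obtain C where C: "C > 0" "\<And>N. norm (cesaro_mean a (of_real t) N) \<le> C"
    using convergent_imp_Bseq[OF convergentI[OF assms]] by (auto simp: Bseq_def)
  have total: "(\<Sum>n=1..N. S n) = of_nat N * cesaro_mean a (of_real t) N" for N
    by (cases "N = 0") (auto simp: cesaro_mean_def S_def)
  have "norm (S N) \<le> 2 * C * real (N + 1) ^ 1" if N: "N \<ge> 1" for N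
  proof -
    obtain i where i: "N = Suc i" using N by (cases N) auto
    have "S N = of_nat N * cesaro_mean a (of_real t) N - of_nat i * cesaro_mean a (of_real t) i"
      unfolding total[symmetric] by (simp add: i)
    also have "norm \<dots> \<le> real N * C + real i * C"
      by (rule order_trans[OF norm_triangle_ineq4]) (auto simp: norm_mult intro!: add_mono mult_left_mono C simp del: of_nat_Suc)
    also have "\<dots> \<le> real (N + 1) * C + real (N + 1) * C"
      using C i by (intro add_mono mult_right_mono) auto
    finally show ?thesis by simp
  qed
  hence "norm (a n) \<le> 2 * (2 * C) * 2 ^ 1 * real n powr (real 1 + t)" if "n \<ge> 1" for n
    unfolding S_def using C(1) that by (intro dirichlet_coeff_bound_of_partial_sums) auto
  thus ?thesis by blast
qed

lemma summable_norm_dirichlet_terms: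
  fixes a :: "nat \<Rightarrow> complex"
  assumes "summable (\<lambda>n. norm (a n) * real n powr - B)" "B \<le> Re s"
  shows "summable (\<lambda>n. norm (a n * of_nat n powr - s))"
  using summable_norm_dirichlet_mono[OF assms] by (simp add: norm_mult norm_of_nat_powr)

section \<open>Equivalence of Cesaro summability and the existence of a Riesz germ\<close>

theorem proposition3p4:
  fixes f :: "complex \<Rightarrow> complex"
  assumes "f holomorphic_on right_half_plane 0"
  shows "(linear_growth f \<and>
            (\<exists>a :: nat \<Rightarrow> complex. \<forall>s\<in>right_half_plane 0. cesaro_mean a s \<longlonglongrightarrow> f s))
         \<longleftrightarrow> f \<in> H_infty_1_log"
proof
  assume "linear_growth f \<and> (\<exists>a. \<forall>s\<in>right_half_plane 0. cesaro_mean a s \<longlonglongrightarrow> f s)"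
  then obtain a where lg: "linear_growth f" and a: "\<And>s. Re s > 0 \<Longrightarrow> cesaro_mean a s \<longlonglongrightarrow> f s"
    by (auto simp: right_half_plane_def)
  obtain D K where "\<And>n. n \<ge> 1 \<Longrightarrow> norm (a n) \<le> D * real n powr K"
    using cesaro_summable_coeff_bound[of a 1 "f 1"] a[of 1] by auto
  hence sm: "summable (\<lambda>n. norm (a n) * real n powr - (K + 2))"
    by (rule summable_dirichlet_of_coeff_bound)
  have "(riesz_mean 0 a s \<longlongrightarrow> f s) at_top" if s: "Re s > max 0 (K + 2)" for s
  proof -
    have sm: "summable (\<lambda>n. norm (a n * of_nat n powr - s))"
      using s by (intro summable_norm_dirichlet_terms[OF sm]) auto
    \<comment> \<open>Where the series converges absolutely, its Cesaro means tend to its sum;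
      uniqueness of limits identifies that sum with \<open>f s\<close>.\<close>
    have "f s = (\<Sum>n. a n * of_nat n powr - s)"
      using a[of s] cesaro_mean_tendsto_suminf[OF sm] s by (auto intro: LIMSEQ_unique)
    thus ?thesis using riesz_mean_tendsto_suminf[OF _ sm, of 0] by simp
  qed
  hence "riesz_germ a f"
    unfolding riesz_germ_def right_half_plane_def
    by (intro exI[of _ 0] conjI exI[of _ "max 0 (K + 2)"]) auto
  thus "f \<in> H_infty_1_log" using lg assms by (auto simp: H_infty_1_log_def)
next
  assume "f \<in> H_infty_1_log"
  then obtain a m \<sigma> where lg: "linear_growth f" and m: "m \<ge> 0" "\<sigma> \<ge> 0"
    and a: "\<And>s. Re s > \<sigma> \<Longrightarrow> (riesz_mean m a s \<longlongrightarrow> f s) at_top"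
    by (auto simp: H_infty_1_log_def riesz_germ_def right_half_plane_def)
  obtain D K where "\<And>n. n \<ge> 1 \<Longrightarrow> norm (a n) \<le> D * real n powr K"
    using riesz_summable_coeff_bound[OF a[of "of_real (\<sigma> + 1)"] m(1)] by auto
  hence sm: "summable (\<lambda>n. norm (a n) * real n powr - (K + 2))"
    by (rule summable_dirichlet_of_coeff_bound)
  \<comment> \<open>The term \<open>\<sigma> + 1\<close> makes the Riesz limit available on the
    closed half-plane \<open>Re s \<ge> B\<close>, and \<open>K + 2\<close> gives absolute
    convergence there.\<close>
  define B where "B = max (\<sigma> + 1) (K + 2)"
  have smB: "summable (\<lambda>n. norm (a n) * real n powr - B)"
    using sm by (rule summable_norm_dirichlet_mono) (simp add: B_def)
  have fs: "(\<lambda>n. a n * of_nat n powr - s) sums f s" if s: "Re s \<ge> B" for s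
  proof -
    have sm: "summable (\<lambda>n. norm (a n * of_nat n powr - s))"
      using s by (rule summable_norm_dirichlet_terms[OF smB])
    have "f s = (\<Sum>n. a n * of_nat n powr - s)"
      using a[of s] riesz_mean_tendsto_suminf[OF m(1) sm] s
      by (auto simp: B_def intro: tendsto_unique[rotated])
    thus ?thesis using sm summable_norm_cancel summable_sums by metis
  qed
  obtain M where M: "\<And>s. Re s > 0 \<Longrightarrow> norm (f s) / (1 + norm s) \<le> M"
    using lg by (auto simp: linear_growth_def bdd_above_def right_half_plane_def)
  have "norm (f s) \<le> M * (1 + norm s)" if "Re s > 0" for s
  proof -
    have "1 + norm s > 0" by (simp add: add_pos_nonneg)
    thus ?thesis using M[OF that] by (simp add: pos_divide_le_eq)
  qed
  hence "cesaro_mean a s \<longlonglongrightarrow> f s" if "Re s > 0" for s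
    using assms smB fs that
    by (intro cesaro_mean_tendsto_of_linear_growth[of f M a B]) (auto simp: right_half_plane_def)
  thus "linear_growth f \<and> (\<exists>a. \<forall>s\<in>right_half_plane 0. cesaro_mean a s \<longlonglongrightarrow> f s)"
    using lg by (auto simp: right_half_plane_def)
qed

end
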